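(* Let $T$ be a minimal $3$-IET which is not of rotation type. Then $T$ has an $n^{th}$ root in $\mathbb{G}$ for some $n\geq 2$ if and only if $T$ fails to satisfy the infinite distinct orbit condition.
   Context: Interval exchange transformations (IETs): fix $m\in\mathbb{N}$, $m\ge 1$, a permutation $\pi$ of $\{1,\dots,m\}$, and $\lambda=(\lambda_1,\dots,\lambda_m)$ in $\Delta_m=\{\lambda\in\mathbb{R}^m:\lambda_i>0,\ \sum_i\lambda_i=1\}$. Put $\beta_0=0$, $\beta_j=\lambda_1+\cdots+\lambda_j$, and $I_j=[\beta_{j-1},\beta_j)$ for $1\le j\le m$. The $m$-IET $T_{(\pi,\lambda)}:[0,1)\to[0,1)$ is the bijection given by $T_{(\pi,\lambda)}(x)=x-\sum_{i<j}\lambda_i+\sum_{\pi(i)<\pi(j)}\lambda_i$ for $x\in I_j$. The set of all IETs forms a group $\mathbb{G}$ under composition, and $S^n$ denotes the $n$-fold composition of $S$. $\mathcal{O}_T(x)=\{T^n(x):n\in\mathbb{Z}\}$ denotes the orbit of $x$; $T$ is minimal if every orbit is dense in $[0,1)$. $T$ is of rotation type if there is $\alpha\in\mathbb{R}$ such that $T(x)=x+\alpha\pmod 1$ for all $x\in[0,1)$. $T$ has an $n^{th}$ root in $\mathbb{G}$ if there is $S\in\mathbb{G}$ with $T=S^n$. An $m$-IET $T$ satisfies the infinite distinct orbit condition (IDOC) if each of the orbits $\mathcal{O}_T(\beta_1),\dots,\mathcal{O}_T(\beta_{m-1})$ is infinite and $\mathcal{O}_T(\beta_i)\cap\mathcal{O}_T(\beta_j)=\emptyset$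 for $i\ne j$. *)

theory Defs
  imports "HOL-Analysis.Analysis" "HOL-Combinatorics.Permutations"
begin

text \<open>
  The length vector is called \<open>l\<close> and \<open>\<beta>\<^sub>j\<close> is \<open>break_point l j\<close>.  Vectors in \<open>\<real>\<^sup>m\<close> are functions
  \<^typ>\<open>nat \<Rightarrow> real\<close> of which only the values at \<open>1, \<dots>, m\<close> are used.
  A bijection of \<open>[0,1)\<close> is represented by its extension to \<^typ>\<open>real\<close> that is the identity
  outside \<open>[0,1)\<close>.  Hence equality of functions is equality of maps on \<open>[0,1)\<close>, \<open>\<circ>\<close> and \<open>^^\<close> are
  composition and iteration there, and \<^term>\<open>inv T\<close> extends the inverse on \<open>[0,1)\<close>.
\<close>

definition length_vectors :: "nat \<Rightarrow> (nat \<Rightarrow> real) set" where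
  "length_vectors m = {l. (\<forall>i\<in>{1..m}. l i > 0) \<and> (\<Sum>i=1..m. l i) = 1}"

definition break_point :: "(nat \<Rightarrow> real) \<Rightarrow> nat \<Rightarrow> real" where
  "break_point l j = (\<Sum>i=1..j. l i)"

definition iet_index :: "nat \<Rightarrow> (nat \<Rightarrow> real) \<Rightarrow> real \<Rightarrow> nat" where
  "iet_index m l x =
     (THE j. j \<in> {1..m} \<and> x \<in> {break_point l (j - 1)..<break_point l j})"

definition iet :: "nat \<Rightarrow> (nat \<Rightarrow> nat) \<Rightarrow> (nat \<Rightarrow> real) \<Rightarrow> real \<Rightarrow> real" where
  "iet m \<pi> l x =
     (if x \<in> {0..<1}
      then let j = iet_index m l x
           in x - (\<Sum>i\<in>{i\<in>{1..m}. i < j}. l i) + (\<Sum>i\<in>{i\<in>{1..m}. \<pi> i < \<pi> j}. l i)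
      else x)"

definition IETs :: "(real \<Rightarrow> real) set" where
  "IETs = {iet m \<pi> l | m \<pi> l. 1 \<le> m \<and> \<pi> permutes {1..m} \<and> l \<in> length_vectors m}"

definition iterate :: "(real \<Rightarrow> real) \<Rightarrow> int \<Rightarrow> real \<Rightarrow> real" where
  "iterate T k = (if 0 \<le> k then T ^^ nat k else inv T ^^ nat (- k))"

definition iet_orbit :: "(real \<Rightarrow> real) \<Rightarrow> real \<Rightarrow> real set" where
  "iet_orbit T x = range (\<lambda>k. iterate T k x)"

definition minimal_iet :: "(real \<Rightarrow> real) \<Rightarrow> bool" where
  "minimal_iet T \<longleftrightarrow> (\<forall>x\<in>{0..<1}. {0..<1} \<subseteq> closure (iet_orbit T x))"

definition rotation_type :: "(real \<Rightarrow> real) \<Rightarrow> bool" where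
  "rotation_type T \<longleftrightarrow> (\<exists>\<alpha>. \<forall>x\<in>{0..<1}. T x = frac (x + \<alpha>))"

definition has_iet_root :: "nat \<Rightarrow> (real \<Rightarrow> real) \<Rightarrow> bool" where
  "has_iet_root n T \<longleftrightarrow> (\<exists>S\<in>IETs. T = S ^^ n)"

text \<open>
  The condition depends on the presentation \<open>(m, \<pi>, l)\<close> through the points \<open>\<beta>\<^sub>1, \<dots>, \<beta>\<^sub>m\<^sub>-\<^sub>1\<close>,
  so it is a predicate of the data and not of the map alone.
\<close>

definition idoc :: "nat \<Rightarrow> (nat \<Rightarrow> nat) \<Rightarrow> (nat \<Rightarrow> real) \<Rightarrow> bool" where
  "idoc m \<pi> l \<longleftrightarrow>
     (\<forall>i\<in>{1..m - 1}. infinite (iet_orbit (iet m \<pi> l) (break_point l i))) \<and>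
     (\<forall>i\<in>{1..m - 1}. \<forall>j\<in>{1..m - 1}. i \<noteq> j \<longrightarrow>
        iet_orbit (iet m \<pi> l) (break_point l i) \<inter> iet_orbit (iet m \<pi> l) (break_point l j) = {})"

end

theory Submission
  imports Defs
begin

text \<open>
  The only permutation that gives a minimal 3-IET not of rotation type reverses the three intervals;
  write \<open>a, b, c\<close> for the lengths.

  If \<open>T\<close> satisfies the IDOC and \<open>T = S\<^sup>n\<close>, then the left-limit map \<open>S\<^sub>-\<close> commutes with
  \<open>T\<^sub>-\<close>.  The left germ at \<open>a + b\<close> has the same past under \<open>T\<^sub>-\<close> as \<open>a + b\<close> under \<open>T\<close>, but is one
  step ahead in the future; at \<open>a\<close> it is one step behind, and on all other orbits there is no delay.
  Delays are preserved by \<open>(S\<^sub>-, S)\<close>, so \<open>S\<^sub>-\<close> maps the \<open>T\<^sub>-\<close>-orbit of \<open>a + b\<close> to itself and acts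
  on it as some \<open>T\<^sub>-\<^sup>i\<close>; hence \<open>i n = 1\<close> and \<open>n = 1\<close>.

  If the IDOC fails, \<open>a\<close> and \<open>a + b\<close> lie on one orbit.  Cutting \<open>[0,1)\<close> along the orbit segment
  between them and regluing left germs to the right germs with the same past and future yields a union of circles
  on which \<open>T\<close> is continuous, so \<open>T\<close> commutes with the translations \<open>\<Phi>\<^sub>s\<close> of these circles.  By
  recurrence and minimality some \<open>\<Phi>\<^sub>s \<circ> T\<^sup>q\<close> with \<open>q \<ge> 1\<close> is the identity, and \<open>T \<circ> \<Phi>\<^sub>t\<close> with
  \<open>t = s / (q + 1)\<close> is a root of order \<open>q + 1\<close>.
\<close>

section \<open>Interval exchanges as piecewise translations\<close>

text \<open>A point of \<open>F\<close> starts a new piece, which is why the gap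
  \<open>{x<..y}\<close> is open at \<open>x\<close>: pieces are closed on the left and the map is
  right-continuous on \<open>{0..<1}\<close>. Bijectivity is a separate condition.\<close>

definition piecewise_translation :: "(real \<Rightarrow> real) \<Rightarrow> bool" where
  "piecewise_translation f \<longleftrightarrow>
     (\<exists>F. finite F \<and> (\<forall>x y. 0 \<le> x \<and> x \<le> y \<and> y < 1 \<and> F \<inter> {x<..y} = {} \<longrightarrow> f y - y = f x - x))"

section \<open>Break points and the intervals between them\<close>

lemma break_point_0 [simp]: "break_point l 0 = 0"
  by (simp add: break_point_def)

lemma break_point_Suc [simp]: "break_point l (Suc j) = break_point l j + l (Suc j)"
  by (simp add: break_point_def)

lemma break_point_mono:
  assumes "l \<in> length_vectors m" "i \<le> j" "j \<le> m"
  shows "break_point l i \<le> break_point l j"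
  unfolding break_point_def
  by (rule sum_mono2) (use assms in \<open>auto simp: length_vectors_def less_imp_le\<close>)

lemma break_point_full: "l \<in> length_vectors m \<Longrightarrow> break_point l m = 1"
  by (simp add: break_point_def length_vectors_def)

lemma interval_index_unique:
  assumes l: "l \<in> length_vectors m" and "i \<in> {1..m}" "j \<in> {1..m}"
    and "x \<in> {break_point l (i - 1)..<break_point l i}"
    and "x \<in> {break_point l (j - 1)..<break_point l j}"
  shows "i = j"
proof (rule ccontr)
  assume "i \<noteq> j"
  have "i - 1 \<le> m" "j - 1 \<le> m" using assms(2,3) by auto
  consider "i \<le> j - 1" | "j \<le> i - 1" using \<open>i \<noteq> j\<close> by linarith
  then show False
    using \<open>i - 1 \<le> m\<close> \<open>j - 1 \<le> m\<close> break_point_mono[OF l, of i "j - 1"] break_point_mono[OF l, of j "i - 1"] assms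
    by cases auto
qed

lemma interval_index_exists:
  assumes l: "l \<in> length_vectors m" and x: "x \<in> {0..<1}"
  obtains j where "j \<in> {1..m}" "x \<in> {break_point l (j - 1)..<break_point l j}"
proof -
  define j where "j = (LEAST j. x < break_point l j)"
  have ex: "x < break_point l m" using break_point_full[OF l] x by simp
  then have 1: "x < break_point l j" unfolding j_def by (rule LeastI)
  have 2: "j \<le> m" unfolding j_def using ex by (rule Least_le)
  have 3: "j \<noteq> 0" using 1 x by (cases j) auto
  then have "\<not> x < break_point l (j - 1)" unfolding j_def
    by (metis diff_less less_numeral_extra(1) not_gr_zero not_less_Least)
  with 1 2 3 that[of j] show thesis by auto
qed

lemma iet_eq:
  assumes l: "l \<in> length_vectors m" and j: "j \<in> {1..m}"
    and x: "x \<in> {break_point l (j - 1)..<break_point l j}"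
  shows "iet m \<pi> l x = x - break_point l (j - 1) + (\<Sum>i | i \<in> {1..m} \<and> \<pi> i < \<pi> j. l i)"
proof -
  have ind: "iet_index m l x = j"
    unfolding iet_index_def
    using j x interval_index_unique[OF l] by (intro the_equality) blast+
  have "0 \<le> break_point l (j - 1)" "break_point l j \<le> 1"
    using break_point_mono[OF l, of 0 "j - 1"] break_point_mono[OF l, of j m]
      break_point_full[OF l] j by auto
  with x have "x \<in> {0..<1}" by auto
  moreover have "{i \<in> {1..m}. i < j} = {1..j - 1}" using j by auto
  ultimately show ?thesis
    by (simp add: iet_def ind break_point_def)
qed

lemma iet_outside: "x \<notin> {0..<1} \<Longrightarrow> iet m \<pi> l x = x"
  unfolding iet_def by (rule if_not_P)

text \<open>The lengths in the order in which the image intervals lie in \<open>{0..<1}\<close>; the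
  break points of this vector are the ends of the image intervals.\<close>

definition permuted_lengths :: "(nat \<Rightarrow> nat) \<Rightarrow> (nat \<Rightarrow> real) \<Rightarrow> nat \<Rightarrow> real" where
  "permuted_lengths \<pi> l i = l (inv \<pi> i)"

lemma permuted_lengths_in:
  assumes "\<pi> permutes {1..m}" "l \<in> length_vectors m"
  shows "permuted_lengths \<pi> l \<in> length_vectors m"
proof -
  have p: "inv \<pi> permutes {1..m}" using assms(1) by (rule permutes_inv)
  have "(\<Sum>i=1..m. l (inv \<pi> i)) = (\<Sum>i=1..m. l i)"
    using sum.permute[OF p, of l] by (simp add: o_def)
  moreover have "inv \<pi> i \<in> {1..m}" if "i \<in> {1..m}" for i
    using permutes_in_image[OF p] that by blast
  ultimately show ?thesis
    using assms(2) by (auto simp: length_vectors_def permuted_lengths_def)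
qed

lemma iet_eq_permuted:
  assumes p: "\<pi> permutes {1..m}" and l: "l \<in> length_vectors m" and j: "j \<in> {1..m}"
    and x: "x \<in> {break_point l (j - 1)..<break_point l j}"
  shows "iet m \<pi> l x =
    x - break_point l (j - 1) + break_point (permuted_lengths \<pi> l) (\<pi> j - 1)"
proof -
  have pj: "\<pi> j \<in> {1..m}" using permutes_in_image[OF p] j by blast
  have "(\<Sum>i | i \<in> {1..m} \<and> \<pi> i < \<pi> j. l i) = (\<Sum>k = 1..\<pi> j - 1. l (inv \<pi> k))"
  proof (rule sum.reindex_bij_witness[of _ "inv \<pi>" \<pi>])
    show "inv \<pi> (\<pi> a) = a" for a using permutes_inverses[OF p] by simp
    show "\<pi> (inv \<pi> a) = a" for a using permutes_inverses[OF p] by simp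
    show "\<pi> a \<in> {1..\<pi> j - 1}" if "a \<in> {i. i \<in> {1..m} \<and> \<pi> i < \<pi> j}" for a
      using that permutes_in_image[OF p, of a] by auto
    show "inv \<pi> b \<in> {i. i \<in> {1..m} \<and> \<pi> i < \<pi> j}" if "b \<in> {1..\<pi> j - 1}" for b
    proof -
      have "b \<in> {1..m}" using that pj by auto
      then have "inv \<pi> b \<in> {1..m}" using permutes_in_image[OF permutes_inv[OF p]] by blast
      then show ?thesis using that permutes_inverses[OF p] by auto
    qed
    show "l (inv \<pi> (\<pi> a)) = l a" for a using permutes_inverses[OF p] by simp
  qed
  then show ?thesis
    using iet_eq[OF l j x] by (simp add: break_point_def permuted_lengths_def)
qed

text \<open>The \<open>j\<close>-th interval is carried onto the interval number
  \<open>\<pi> j\<close> of the permuted partition, so the exchange of that partition by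
  \<open>inv \<pi>\<close> moves it back.\<close>

lemma iet_inverse:
  assumes p: "\<pi> permutes {1..m}" and l: "l \<in> length_vectors m"
  shows "iet m (inv \<pi>) (permuted_lengths \<pi> l) (iet m \<pi> l x) = x"
proof (cases "x \<in> {0..<1}")
  case True
  let ?l' = "permuted_lengths \<pi> l"
  obtain j where j: "j \<in> {1..m}" and x: "x \<in> {break_point l (j - 1)..<break_point l j}"
    using interval_index_exists[OF l True] .
  have pj: "\<pi> j \<in> {1..m}" using permutes_in_image[OF p] j by blast
  have ipj: "inv \<pi> (\<pi> j) = j" using permutes_inverses[OF p] by simp
  let ?y = "iet m \<pi> l x"
  have y: "?y = x - break_point l (j - 1) + break_point ?l' (\<pi> j - 1)"
    by (rule iet_eq_permuted[OF p l j x])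
  have "break_point l j = break_point l (j - 1) + l j"
    using break_point_Suc[of l "j - 1"] j by (simp del: break_point_Suc)
  moreover have "break_point ?l' (\<pi> j) = break_point ?l' (\<pi> j - 1) + l j"
    using break_point_Suc[of ?l' "\<pi> j - 1"] pj ipj
    by (simp add: permuted_lengths_def del: break_point_Suc)
  ultimately have y_in: "?y \<in> {break_point ?l' (\<pi> j - 1)..<break_point ?l' (\<pi> j)}"
    using x y by auto
  have ii: "permuted_lengths (inv \<pi>) ?l' = l"
    using p by (auto simp: permuted_lengths_def inv_inv_eq permutes_bij permutes_inverses fun_eq_iff)
  show ?thesis
    using iet_eq_permuted[OF permutes_inv[OF p] permuted_lengths_in[OF p l] pj y_in] y
    by (simp add: ii ipj)
qed (simp add: iet_outside del: atLeastLessThan_iff)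

lemma bij_iet:
  assumes p: "\<pi> permutes {1..m}" and l: "l \<in> length_vectors m"
  shows "bij (iet m \<pi> l)"
proof -
  have "permuted_lengths (inv \<pi>) (permuted_lengths \<pi> l) = l"
    using p by (auto simp: permuted_lengths_def inv_inv_eq permutes_bij permutes_inverses fun_eq_iff)
  then have "iet m \<pi> l (iet m (inv \<pi>) (permuted_lengths \<pi> l) x) = x" for x
    using iet_inverse[OF permutes_inv[OF p] permuted_lengths_in[OF p l]] p
    by (simp add: inv_inv_eq permutes_bij)
  then show ?thesis
    using iet_inverse[OF p l]
    by (intro o_bij[of "iet m (inv \<pi>) (permuted_lengths \<pi> l)"]) (simp_all add: fun_eq_iff)
qed

lemma piecewise_translation_iet:
  assumes l: "l \<in> length_vectors m"
  shows "piecewise_translation (iet m \<pi> l)"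
  unfolding piecewise_translation_def
proof (intro exI[of _ "break_point l ` {0..m}"] conjI allI impI)
  fix x y :: real
  assume *: "0 \<le> x \<and> x \<le> y \<and> y < 1 \<and> break_point l ` {0..m} \<inter> {x<..y} = {}"
  obtain j where j: "j \<in> {1..m}" and x: "x \<in> {break_point l (j - 1)..<break_point l j}"
    using interval_index_exists[OF l, of x] * by auto
  have "break_point l j \<in> break_point l ` {0..m}" using j by auto
  then have "break_point l j \<notin> {x<..y}" using * by blast
  then have y: "y \<in> {break_point l (j - 1)..<break_point l j}" using x * by auto
  show "iet m \<pi> l y - y = iet m \<pi> l x - x"
    using iet_eq[OF l j x] iet_eq[OF l j y] by simp
qed simp

lemma bij_image_unit:
  assumes "bij f" and out: "\<And>x. x \<notin> {0..<1} \<Longrightarrow> f x = x" and x: "x \<in> {0..<1::real}"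
  shows "f x \<in> {0..<1}"
proof (rule ccontr)
  assume n: "f x \<notin> {0..<1}"
  then have "f (f x) = f x" by (rule out)
  then have "f x = x" using bij_is_inj[OF \<open>bij f\<close>] by (simp add: inj_eq)
  with x n show False by simp
qed

text \<open>Recovers a presentation from the map: the sorted cuts give the lengths, and the order of
  the images of the pieces gives the permutation. This is how a root, built as a composition, is
  recognised as an IET.\<close>

lemma IETs_I:
  assumes bij: "bij f" and out: "\<And>x. x \<notin> {0..<1} \<Longrightarrow> f x = x"
    and pt: "piecewise_translation f"
  shows "f \<in> IETs"
proof -
  obtain F where F: "finite F"
    and tr: "\<And>x y. \<lbrakk>0 \<le> x; x \<le> y; y < 1; F \<inter> {x<..y} = {}\<rbrakk> \<Longrightarrow> f y - y = f x - x"
    using pt unfolding piecewise_translation_def by blast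
  \<comment> \<open>With \<open>0\<close> and \<open>1\<close> added and outer cuts dropped, the
    sorted cuts run exactly from \<open>0\<close> to \<open>1\<close>.\<close>
  define G where "G = insert 0 (insert 1 (F \<inter> {0..1}))"
  have fG: "finite G" using F by (simp add: G_def)
  define xs where "xs = sorted_list_of_set G"
  have set: "set xs = G" and sorted: "sorted_wrt (<) xs"
    using fG by (auto simp: xs_def)
  define m where "m = length xs - 1"
  have "card G \<ge> 2" using card_mono[OF fG, of "{0,1}"] by (auto simp: G_def)
  then have len: "length xs = Suc m" and m1: "1 \<le> m"
    by (auto simp: m_def xs_def)
  define b where "b i = xs ! i" for i
  have b_less: "b i < b j" if "i < j" "j \<le> m" for i j
    using sorted_wrt_nth_less[OF sorted, of i j] that len by (simp add: b_def)
  have b_le: "b i \<le> b j" if "i \<le> j" "j \<le> m" for i j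
    using b_less[of i j] that by (cases "i = j") auto
  have bG: "b i \<in> G" if "i \<le> m" for i
    using that set len nth_mem[of i xs] by (auto simp: b_def)
  have Gb: "\<exists>i\<le>m. g = b i" if "g \<in> G" for g
    using that set len by (auto simp: in_set_conv_nth b_def less_Suc_eq_le)
  have G01: "0 \<le> g \<and> g \<le> 1" if "g \<in> G" for g using that by (auto simp: G_def)
  have b0: "b 0 = 0"
  proof -
    obtain i where "i \<le> m" "0 = b i" using Gb[of 0] by (auto simp: G_def)
    then show ?thesis using b_le[of 0 i] G01[OF bG[of 0]] by auto
  qed
  have bm: "b m = 1"
  proof -
    obtain i where "i \<le> m" "1 = b i" using Gb[of 1] by (auto simp: G_def)
    then show ?thesis using b_le[of i m] G01[OF bG[of m]] by auto
  qed
  define l where "l i = b i - b (i - 1)" for i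
  have bp: "break_point l j = b j" for j
    by (induction j) (auto simp: b0 l_def)
  have l_pos: "l i > 0" if "i \<in> {1..m}" for i
    using b_less[of "i - 1" i] that by (auto simp: l_def)
  have l: "l \<in> length_vectors m"
    using l_pos bp[of m] bm by (auto simp: length_vectors_def break_point_def)
  define v where "v i = f (b (i - 1))" for i
  have f_on: "f x = x - b (i - 1) + v i" if i: "i \<in> {1..m}" and x: "x \<in> {b (i - 1)..<b i}" for i x
  proof -
    have i': "i - 1 \<le> m" "i \<le> m" using i by auto
    have "False" if "g \<in> F" "b (i - 1) < g" "g \<le> x" for g
    proof -
      have "g \<in> G" using that x G01[OF bG[OF i'(1)]] G01[OF bG[OF i'(2)]] by (auto simp: G_def)
      then obtain k where k: "k \<le> m" "g = b k" using Gb by blast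
      have "i - 1 < k" using b_le[of k "i - 1"] k that i' by force
      moreover have "k < i" using b_le[of i k] k that x by force
      ultimately show False by linarith
    qed
    then have "F \<inter> {b (i - 1)<..x} = {}" by auto
    then show ?thesis
      using tr[of "b (i - 1)" x] x G01[OF bG[OF i'(1)]] G01[OF bG[OF i'(2)]]
      by (auto simp: v_def)
  qed
  define J where "J i = {v i..<v i + l i}" for i
  have fJ: "f ` {b (i - 1)..<b i} = J i" if i: "i \<in> {1..m}" for i
  proof -
    have "f ` {b (i - 1)..<b i} = (\<lambda>x. x + (v i - b (i - 1))) ` {b (i - 1)..<b i}"
      by (rule image_cong) (use f_on[OF i] in auto)
    also have "\<dots> = {b (i - 1) + (v i - b (i - 1))..<b i + (v i - b (i - 1))}"
      by simp
    finally show ?thesis by (simp add: J_def l_def algebra_simps)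
  qed
  have disj: "i = k" if ik: "i \<in> {1..m}" "k \<in> {1..m}" and y: "y \<in> J i" "y \<in> J k" for i k y
  proof -
    obtain x x' where "f x = y" "x \<in> {b (i - 1)..<b i}" "f x' = y" "x' \<in> {b (k - 1)..<b k}"
      using y fJ[OF ik(1)] fJ[OF ik(2)] by (metis imageE)
    then show ?thesis
      using interval_index_unique[OF l ik, of x] bij by (auto simp: bp dest: bij_is_inj injD)
  qed
  have v_J: "v i \<in> J i" if "i \<in> {1..m}" for i using l_pos[OF that] by (simp add: J_def)
  have v_inj: "i = k" if "i \<in> {1..m}" "k \<in> {1..m}" "v i = v k" for i k
    using disj[OF that(1,2), of "v i"] v_J[OF that(1)] v_J[OF that(2)] that(3) by simp
  have v01: "v i \<in> {0..<1}" if i: "i \<in> {1..m}" for i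
  proof -
    have "b (i - 1) \<in> {0..<1}"
      using G01[OF bG[of "i - 1"]] b_less[of "i - 1" m] bm i by auto
    then show ?thesis unfolding v_def using bij_image_unit[OF bij out] by blast
  qed
  \<comment> \<open>The images of the pieces that land to the left of \<open>v i\<close> tile
    \<open>{0..<v i}\<close>; comparing Lebesgue measures shows that the offset is the sum of their
    lengths.\<close>
  have sum_v: "(\<Sum>k | k \<in> {1..m} \<and> v k < v i. l k) = v i" if i: "i \<in> {1..m}" for i
  proof -
    let ?I = "{k. k \<in> {1..m} \<and> v k < v i}"
    have "{0..<v i} = (\<Union>k\<in>?I. J k)"
    proof (intro equalityI subsetI)
      fix y assume y: "y \<in> {0..<v i}"
      obtain x where x: "f x = y" using bij by (metis bij_pointE)
      have "x \<in> {0..<1}"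
      proof (rule ccontr)
        assume "x \<notin> {0..<1}"
        then show False using out[of x] x y v01[OF i] by auto
      qed
      then obtain k where k: "k \<in> {1..m}" "x \<in> {b (k - 1)..<b k}"
        using interval_index_exists[OF l] by (metis bp)
      then have "y \<in> J k" using fJ[of k] x by blast
      moreover have "v k < v i" using \<open>y \<in> J k\<close> y by (auto simp: J_def)
      ultimately show "y \<in> (\<Union>k\<in>?I. J k)" using k by blast
    next
      fix y assume "y \<in> (\<Union>k\<in>?I. J k)"
      then obtain k where k: "k \<in> {1..m}" "v k < v i" and y: "y \<in> J k" by blast
      have "v i \<notin> J k" using disj[OF k(1) i, of "v i"] v_J[OF i] k by auto
      then show "y \<in> {0..<v i}" using y k v01[OF k(1)] by (auto simp: J_def)
    qed
    then have "measure lborel {0..<v i} = measure lborel (\<Union>k\<in>?I. J k)" by simp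
    also have "\<dots> = (\<Sum>k\<in>?I. measure lborel (J k))"
    proof (rule measure_finite_Union)
      show "disjoint_family_on J ?I" using disj by (auto simp: disjoint_family_on_def)
    qed (auto simp: J_def less_imp_le l_pos)
    also have "\<dots> = (\<Sum>k\<in>?I. l k)"
      by (rule sum.cong) (auto simp: J_def less_imp_le l_pos)
    finally show ?thesis using v01[OF i] by simp
  qed
  \<comment> \<open>The rank of the image of piece \<open>i\<close> from the left, with the identity
    outside the index set as \<open>permutes\<close> demands.\<close>
  define \<pi> where "\<pi> i = (if i \<in> {1..m} then card {k \<in> {1..m}. v k \<le> v i} else i)" for i
  have pi_less: "\<pi> k < \<pi> i" if "k \<in> {1..m}" "i \<in> {1..m}" "v k < v i" for k i
  proof -
    have "{j \<in> {1..m}. v j \<le> v k} \<subseteq> {j \<in> {1..m}. v j \<le> v i}" using that by auto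
    moreover have "i \<in> {j \<in> {1..m}. v j \<le> v i}" "i \<notin> {j \<in> {1..m}. v j \<le> v k}" using that by auto
    ultimately have "{j \<in> {1..m}. v j \<le> v k} \<subset> {j \<in> {1..m}. v j \<le> v i}" by blast
    then have "card {j \<in> {1..m}. v j \<le> v k} < card {j \<in> {1..m}. v j \<le> v i}"
      by (intro psubset_card_mono) auto
    then show ?thesis using that by (simp add: \<pi>_def)
  qed
  have pi_less_iff: "\<pi> k < \<pi> i \<longleftrightarrow> v k < v i" if "k \<in> {1..m}" "i \<in> {1..m}" for k i
    using pi_less[OF that] pi_less[of i k] v_inj[of i k] that
    by (metis less_asym linorder_neqE_linordered_idom order_less_irrefl)
  have pi_in: "\<pi> i \<in> {1..m}" if "i \<in> {1..m}" for i
  proof -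
    have "card {k \<in> {1..m}. v k \<le> v i} \<le> card {1..m}" by (rule card_mono) auto
    moreover have "card {k \<in> {1..m}. v k \<le> v i} > 0" using that by (auto simp: card_gt_0_iff)
    ultimately show ?thesis using that by (auto simp: \<pi>_def)
  qed
  have "inj_on \<pi> {1..m}"
    using pi_less_iff v_inj by (intro inj_onI) (metis less_irrefl linorder_neqE_linordered_idom)
  then have "bij_betw \<pi> {1..m} {1..m}"
    using pi_in by (intro bij_betw_imageI endo_inj_surj) auto
  then have p: "\<pi> permutes {1..m}"
    by (rule bij_imp_permutes) (simp only: \<pi>_def if_False)
  have "f x = iet m \<pi> l x" for x
  proof (cases "x \<in> {0..<1}")
    case True
    then obtain i where i: "i \<in> {1..m}" and x: "x \<in> {break_point l (i - 1)..<break_point l i}"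
      using interval_index_exists[OF l] by blast
    have "{k. k \<in> {1..m} \<and> \<pi> k < \<pi> i} = {k. k \<in> {1..m} \<and> v k < v i}"
      using pi_less_iff i by auto
    then have "iet m \<pi> l x = x - b (i - 1) + v i"
      using iet_eq[OF l i x] sum_v[OF i] by (simp add: bp)
    then show ?thesis using f_on[OF i] x by (simp add: bp)
  next
    case False
    then show ?thesis using out[OF False] iet_outside[OF False] by simp
  qed
  then have "f = iet m \<pi> l" by blast
  then show ?thesis using m1 p l unfolding IETs_def by blast
qed

lemma IETs_iff:
  "f \<in> IETs \<longleftrightarrow> bij f \<and> (\<forall>x. x \<notin> {0..<1} \<longrightarrow> f x = x) \<and> piecewise_translation f"
proof
  assume "f \<in> IETs"
  then obtain m \<pi> l where *: "f = iet m \<pi> l" "\<pi> permutes {1..m}" "l \<in> length_vectors m"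
    unfolding IETs_def by blast
  then show "bij f \<and> (\<forall>x. x \<notin> {0..<1} \<longrightarrow> f x = x) \<and> piecewise_translation f"
    using bij_iet piecewise_translation_iet iet_outside by blast
qed (use IETs_I in blast)

text \<open>Cuts of the composition are those of \<open>g\<close> and the \<open>g\<close>-preimages
  of those of \<open>f\<close>; injectivity of \<open>g\<close> keeps the latter finite.\<close>

lemma piecewise_translation_comp:
  assumes f: "piecewise_translation f" and g: "piecewise_translation g"
    and inj: "inj_on g {0..<1}" and im: "g ` {0..<1} \<subseteq> {0..<1}"
  shows "piecewise_translation (f \<circ> g)"
proof -
  obtain F where F: "finite F"
    "\<And>x y. \<lbrakk>0 \<le> x; x \<le> y; y < 1; F \<inter> {x<..y} = {}\<rbrakk> \<Longrightarrow> f y - y = f x - x"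
    using f unfolding piecewise_translation_def by blast
  obtain G where G: "finite G"
    "\<And>x y. \<lbrakk>0 \<le> x; x \<le> y; y < 1; G \<inter> {x<..y} = {}\<rbrakk> \<Longrightarrow> g y - y = g x - x"
    using g unfolding piecewise_translation_def by blast
  have "finite (G \<union> (g -` F \<inter> {0..<1}))"
    using F(1) G(1) inj by (simp add: finite_vimage_IntI)
  moreover have "(f \<circ> g) y - y = (f \<circ> g) x - x"
    if xy: "0 \<le> x" "x \<le> y" "y < 1" and e: "(G \<union> (g -` F \<inter> {0..<1})) \<inter> {x<..y} = {}" for x y
  proof -
    have gz: "g z = g x + (z - x)" if "z \<in> {x..y}" for z
    proof -
      have "G \<inter> {x<..z} = {}" using e that by fastforce
      then show ?thesis using G(2)[of x z] that xy by auto
    qed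
    \<comment> \<open>Since \<open>g\<close> translates \<open>{x..y}\<close>, a cut of
      \<open>f\<close> in the image would pull back to an excluded point of
      \<open>{x<..y}\<close>.\<close>
    have "p \<notin> F" if p: "p \<in> {g x<..g y}" for p
    proof
      assume "p \<in> F"
      define z where "z = x + (p - g x)"
      have "z \<in> {x<..y}" using p gz[of y] xy by (auto simp: z_def)
      moreover have "g z = p" using gz[of z] \<open>z \<in> {x<..y}\<close> by (auto simp: z_def)
      ultimately have "z \<in> (g -` F \<inter> {0..<1}) \<inter> {x<..y}" using xy \<open>p \<in> F\<close> by auto
      then show False using e by blast
    qed
    then have "F \<inter> {g x<..g y} = {}" by blast
    moreover have "x \<in> {0..<1}" "y \<in> {0..<1}" using xy by auto
    then have "g x \<in> {0..<1}" "g y \<in> {0..<1}" using im by blast+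
    ultimately have "f (g y) - g y = f (g x) - g x" using F(2)[of "g x" "g y"] gz[of y] xy by auto
    then show ?thesis using gz[of y] xy by auto
  qed
  ultimately show ?thesis unfolding piecewise_translation_def by blast
qed

lemma finite_gap_right:
  fixes x :: real assumes "finite F"
  obtains \<eta> where "\<eta> > 0" "F \<inter> {x<..<x + \<eta>} = {}"
proof -
  obtain d where "d > 0" "\<forall>p\<in>F. p \<noteq> x \<longrightarrow> d \<le> dist x p"
    using finite_set_avoid[OF assms] by blast
  then show thesis by (intro that[of d]) (force simp: dist_real_def)+
qed

lemma piecewise_translation_right:
  assumes "piecewise_translation f" "x \<in> {0..<1}"
  obtains \<eta> where "\<eta> > 0" "\<And>h. 0 \<le> h \<Longrightarrow> h < \<eta> \<Longrightarrow> x + h < 1 \<and> f (x + h) = f x + h"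
proof -
  obtain F where F: "finite F"
    "\<And>x y. \<lbrakk>0 \<le> x; x \<le> y; y < 1; F \<inter> {x<..y} = {}\<rbrakk> \<Longrightarrow> f y - y = f x - x"
    using assms unfolding piecewise_translation_def by blast
  obtain \<eta> where \<eta>: "\<eta> > 0" "F \<inter> {x<..<x + \<eta>} = {}" using finite_gap_right[OF F(1)] .
  show thesis
  proof (rule that[of "min \<eta> (1 - x)"])
    fix h assume h: "0 \<le> h" "h < min \<eta> (1 - x)"
    have "F \<inter> {x<..x + h} = {}" using \<eta>(2) h by fastforce
    then show "x + h < 1 \<and> f (x + h) = f x + h"
      using F(2)[of x "x + h"] h assms(2) by auto
  qed (use \<eta> assms in auto)
qed

text \<open>Near \<open>x\<close> on the right, \<open>f\<close> is one translation, and by density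
  the orbit of fixed points enters this piece; the translation is therefore by zero.\<close>

lemma minimal_fixed_imp_id:
  assumes f: "piecewise_translation f" and fix_orbit: "\<And>k. f (iterate T k z) = iterate T k z"
    and min: "minimal_iet T" and z: "z \<in> {0..<1}" and x: "x \<in> {0..<1}"
  shows "f x = x"
proof -
  obtain \<eta> where \<eta>: "\<eta> > 0" "\<And>h. 0 \<le> h \<Longrightarrow> h < \<eta> \<Longrightarrow> x + h < 1 \<and> f (x + h) = f x + h"
    using piecewise_translation_right[OF f x] by blast
  \<comment> \<open>An interior point of the piece: density is applied there and not at
    \<open>x\<close>, whose nearby orbit points could all lie on its left.\<close>
  let ?h = "min (\<eta> / 2) ((1 - x) / 2)"
  have "x + ?h \<in> {0..<1}" using x \<eta> by (auto simp: min_def)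
  then have "x + ?h \<in> closure (iet_orbit T z)" using min z unfolding minimal_iet_def by blast
  moreover have "open {x<..<x + \<eta>}" "x + ?h \<in> {x<..<x + \<eta>}" using \<eta> x by (auto simp: min_def)
  ultimately obtain y where y: "y \<in> {x<..<x + \<eta>}" "y \<in> iet_orbit T z"
    by (metis IntI disjoint_iff closure_iff_nhds_not_empty interior_open subset_refl)
  have "f y = y" using y(2) fix_orbit unfolding iet_orbit_def by blast
  then show ?thesis using \<eta>(2)[of "y - x"] y(1) by auto
qed

section \<open>Integer iterates and orbits\<close>

lemma iterate_nat: "iterate T (int n) = T ^^ n"
  by (simp add: iterate_def)

lemma iterate_0 [simp]: "iterate T 0 = id"
  by (simp add: iterate_def)

lemma iterate_1 [simp]: "iterate T 1 = T"
  by (simp add: iterate_def)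

lemma iterate_add_1:
  assumes "bij T" shows "iterate T (k + 1) = T \<circ> iterate T k"
proof (cases "0 \<le> k")
  case True
  then have "nat (k + 1) = Suc (nat k)" by simp
  then show ?thesis using True by (simp add: iterate_def)
next
  case False
  then have "nat (- k) = Suc (nat (- (k + 1)))" by simp
  then have *: "iterate T k = inv T \<circ> (inv T ^^ nat (- (k + 1)))" using False by (simp add: iterate_def)
  have "T \<circ> inv T = id" using bij_is_surj[OF assms] by (simp only: surj_iff)
  then have "T \<circ> iterate T k = inv T ^^ nat (- (k + 1))"
    unfolding * by (simp add: o_assoc)
  moreover have "iterate T (k + 1) = inv T ^^ nat (- (k + 1))"
    using False by (cases "k = -1") (auto simp: iterate_def)
  ultimately show ?thesis by simp
qed

text \<open>Injectivity allows induction backwards as well as forwards. This turns one-step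
  identities into statements about whole two-sided orbits.\<close>

lemma bij_step_eq_iterate:
  assumes bij: "bij T" and step: "\<And>k. T (w k) = w (k + 1)"
  shows "w k = iterate T k (w 0)"
proof (induction k rule: int_induct[of _ 0])
  case (step1 i)
  then show ?case using step[of i] iterate_add_1[OF bij, of i] by simp
next
  case (step2 i)
  have "T (w (i - 1)) = T (iterate T (i - 1) (w 0))"
    using step[of "i - 1"] iterate_add_1[OF bij, of "i - 1"] step2 by (simp add: fun_eq_iff)
  then show ?case using bij by (simp add: bij_is_inj inj_eq)
qed simp

lemma iterate_step:
  assumes "bij T" shows "T (iterate T k x) = iterate T (k + 1) x"
  using iterate_add_1[OF assms] by simp

lemma iterate_add:
  assumes "bij T" shows "iterate T (i + j) x = iterate T i (iterate T j x)"
proof -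
  have "iterate T (i + j) x = iterate T i (iterate T (0 + j) x)"
    by (rule bij_step_eq_iterate[OF assms, where w = "\<lambda>i. iterate T (i + j) x"])
      (simp add: iterate_step[OF assms] algebra_simps)
  then show ?thesis by simp
qed

lemma iterate_commute:
  assumes "bij T" "\<And>x. f (T x) = T (f x)"
  shows "f (iterate T k x) = iterate T k (f x)"
  using bij_step_eq_iterate[OF assms(1), of "\<lambda>k. f (iterate T k x)"]
  by (simp add: iterate_step[OF assms(1)] assms(2)[symmetric])

lemma iterate_unit:
  assumes "bij T" "\<And>x. x \<in> A \<Longrightarrow> T x \<in> A" "\<And>x. x \<notin> A \<Longrightarrow> T x = x" "x \<in> A"
  shows "iterate T k x \<in> A"
proof (induction k rule: int_induct[of _ 0])
  \<comment> \<open>Had the earlier point been outside \<open>A\<close>, \<open>T\<close> would fix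
    it, and the later point would be outside too.\<close>
  case (step2 i)
  then show ?case using assms(3)[of "iterate T (i - 1) x"] iterate_step[OF assms(1), of "i - 1" x]
    by force
qed (use assms iterate_step[OF assms(1), symmetric] in auto)

text \<open>A coincidence of two iterates gives a period \<open>p\<close>, and then only the
  residues modulo \<open>p\<close> contribute points.\<close>

lemma infinite_orbit_inj:
  assumes bij: "bij T" and inf: "infinite (iet_orbit T x)"
  shows "inj (\<lambda>k. iterate T k x)"
proof (rule ccontr)
  assume "\<not> ?thesis"
  then obtain i j where "iterate T i x = iterate T j x" "i \<noteq> j" by (auto simp: inj_def)
  then obtain i j where ij: "iterate T i x = iterate T j x" "i < j"
    by (metis linorder_neqE_linordered_idom)
  define p where "p = j - i"
  have p: "p > 0" using ij by (simp add: p_def)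
  have "iterate T p x = iterate T (-i) (iterate T j x)"
    using iterate_add[OF bij, of "-i" j x] by (simp add: p_def)
  also have "\<dots> = x" using iterate_add[OF bij, of "-i" i x] ij by simp
  finally have per: "iterate T p x = x" .
  have mult: "iterate T (p * q) x = x" for q
  proof -
    have "iterate T (p * q) x = iterate T (p * (q + 1)) x" for q
      using iterate_add[OF bij, of "p * q" p x] per by (simp add: algebra_simps)
    \<comment> \<open>The values at multiples of \<open>p\<close> form a two-sided orbit of the
      identity map.\<close>
    then have "iterate T (p * q) x = iterate id q (iterate T (p * 0) x)"
      by (intro bij_step_eq_iterate[OF bij_id]) simp
    moreover have "inv id = (id :: real \<Rightarrow> real)" by (rule inv_id)
    ultimately show ?thesis by (simp add: iterate_def)
  qed
  have "iet_orbit T x \<subseteq> (\<lambda>k. iterate T k x) ` {0..<p}"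
  proof
    fix y assume "y \<in> iet_orbit T x"
    then obtain k where "y = iterate T k x" unfolding iet_orbit_def by blast
    also have "\<dots> = iterate T (k mod p) (iterate T (p * (k div p)) x)"
      using iterate_add[OF bij, of "k mod p" "p * (k div p)" x] by (simp add: add.commute)
    finally have "y = iterate T (k mod p) x" by (simp only: mult)
    then show "y \<in> (\<lambda>k. iterate T k x) ` {0..<p}" using p by auto
  qed
  then have "finite (iet_orbit T x)" by (rule finite_subset) simp
  then show False using inf by simp
qed

lemma minimal_infinite_orbit:
  assumes "minimal_iet T" "x \<in> {0..<1}" shows "infinite (iet_orbit T x)"
proof
  assume "finite (iet_orbit T x)"
  then have "{0..<1} \<subseteq> iet_orbit T x"
    using assms unfolding minimal_iet_def by (metis closure_closed finite_imp_closed)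
  then show False
    using \<open>finite (iet_orbit T x)\<close> by (metis finite_subset infinite_Ico zero_less_one)
qed

section \<open>Roots from a commuting flow\<close>

lemma funpow_commute:
  assumes "f \<circ> g = g \<circ> f" shows "(f ^^ n) \<circ> g = g \<circ> (f ^^ n)"
proof
  have "f (g x) = g (f x)" for x using assms by (metis comp_apply)
  then show "((f ^^ n) \<circ> g) x = (g \<circ> (f ^^ n)) x" for x
    by (induction n arbitrary: x) simp_all
qed

lemma funpow_comp_commute:
  assumes "f \<circ> g = g \<circ> f" shows "(f \<circ> g) ^^ n = (f ^^ n) \<circ> (g ^^ n)"
proof (induction n)
  case (Suc n)
  have "(f ^^ n) (g x) = g ((f ^^ n) x)" for x
    using funpow_commute[OF assms, of n] by (metis comp_apply)
  then show ?case using Suc by (simp add: fun_eq_iff)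
qed simp

lemma piecewise_translation_funpow:
  assumes "bij f" "\<And>x. x \<notin> {0..<1} \<Longrightarrow> f x = x" "piecewise_translation f"
  shows "piecewise_translation (f ^^ n)"
proof (induction n)
  case 0
  show ?case by (auto simp: piecewise_translation_def)
next
  case (Suc n)
  have "piecewise_translation ((f ^^ n) \<circ> f)"
  proof (rule piecewise_translation_comp[OF Suc assms(3)])
    show "inj_on f {0..<1}" using bij_is_inj[OF assms(1)] by (rule inj_on_subset) simp
    show "f ` {0..<1} \<subseteq> {0..<1}" using bij_image_unit[OF assms(1,2)] by blast
  qed
  then show ?case by (simp only: funpow_Suc_right)
qed

text \<open>What the construction of a root uses of the translations along circles: a local
  semigroup of piecewise translations, with laws only for times below \<open>\<epsilon>\<close>,
  commuting with \<open>T\<close>. Away from the finite set \<open>K\<close> of cuts,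
  \<open>\<Phi> s\<close> is the shift by \<open>s\<close>.\<close>

locale commuting_flow =
  fixes T :: "real \<Rightarrow> real" and \<Phi> :: "real \<Rightarrow> real \<Rightarrow> real" and \<epsilon> :: real and K :: "real set"
  assumes bij: "bij T" and outside: "\<And>x. x \<notin> {0..<1} \<Longrightarrow> T x = x"
    and pt: "piecewise_translation T" and min: "minimal_iet T"
    and \<epsilon>: "\<epsilon> > 0" and finK: "finite K"
    and flow_pt: "\<And>s. 0 < s \<Longrightarrow> s < \<epsilon> \<Longrightarrow> piecewise_translation (\<Phi> s)"
    and flow_out: "\<And>s x. x \<notin> {0..<1} \<Longrightarrow> \<Phi> s x = x"
    and flow_add: "\<And>s t. 0 < s \<Longrightarrow> 0 < t \<Longrightarrow> s + t < \<epsilon> \<Longrightarrow> \<Phi> s \<circ> \<Phi> t = \<Phi> (s + t)"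
    and flow_commute: "\<And>s. 0 < s \<Longrightarrow> s < \<epsilon> \<Longrightarrow> T \<circ> \<Phi> s = \<Phi> s \<circ> T"
    and flow_shift: "\<And>s x. 0 < s \<Longrightarrow> 0 \<le> x \<Longrightarrow> x + s < 1 \<Longrightarrow> K \<inter> {x<..x + s} = {} \<Longrightarrow> \<Phi> s x = x + s"
begin

text \<open>A monotone subsequence \<open>c\<close> of the orbit of \<open>0\<close> converges, so
  its late terms lie close together with no cut between them, and the flow carries the lower term to
  the higher one. The sign of the power of \<open>T\<close> depends on the direction of
  monotonicity.\<close>

lemma flow_return:
  obtains q s z where "q \<ge> 1" "0 < s" "s < \<epsilon>" "z \<in> {0..<1}" "\<Phi> s ((T ^^ q) z) = z"
proof -
  define p where "p i = (T ^^ i) 0" for i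
  have p_unit: "p i \<in> {0..<1}" for i
    using iterate_unit[OF bij bij_image_unit[OF bij outside] outside, of 0 "int i"]
    by (simp add: p_def iterate_nat)
  have T_p: "(T ^^ i) (p j) = p (i + j)" for i j by (simp add: p_def funpow_add)
  have p_inj: "p i = p j \<Longrightarrow> i = j" for i j
    using injD[OF infinite_orbit_inj[OF bij minimal_infinite_orbit[OF min, of 0]], of "int i" "int j"]
    by (simp add: p_def iterate_nat)
  obtain r where r: "strict_mono r" "monoseq (p \<circ> r)"
    using seq_monosub[of p] by (auto simp: o_def)
  define c where "c = p \<circ> r"
  have c_unit: "c i \<in> {0..<1}" for i using p_unit by (simp add: c_def)
  have c_inj: "c i = c j \<Longrightarrow> i = j" for i j
    using p_inj strict_mono_eq[OF r(1)] by (auto simp: c_def)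
  have "Bseq c" using c_unit by (intro BseqI'[of _ 1]) (auto simp: less_imp_le)
  then obtain L where L: "c \<longlonglongrightarrow> L"
    using r(2) Bseq_monoseq_convergent unfolding c_def convergent_def by blast
  obtain d where d: "d > 0" "\<forall>k\<in>K. k \<noteq> L \<longrightarrow> d \<le> dist L k"
    using finite_set_avoid[OF finK] by blast
  have Phi_c: "\<Phi> (c j - c i) (c i) = c j"
    if "c i < c j" "\<And>k. k \<in> K \<Longrightarrow> k \<notin> {c i<..c j}" for i j
  proof -
    have "K \<inter> {c i<..c j} = {}" using that(2) by blast
    then show ?thesis
      using flow_shift[of "c j - c i" "c i"] that(1) c_unit[of i] c_unit[of j] by auto
  qed
  have "\<exists>q s z. q \<ge> 1 \<and> 0 < s \<and> s < \<epsilon> \<and> z \<in> {0..<1} \<and> \<Phi> s ((T ^^ q) z) = z"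
  proof -
    consider "incseq c" | "decseq c" using r(2) unfolding c_def monoseq_iff by blast
    then show ?thesis
    proof cases
      \<comment> \<open>In the decreasing case the flow carries the later term
        \<open>c (Suc i)\<close> up to the earlier term \<open>c i\<close>, so it undoes a positive
        power of \<open>T\<close>.\<close>
      case 2
      have "L \<le> c i" for i using decseq_ge[OF 2 L] .
      then have L_less: "L < c i" for i
        using 2 c_inj[of i "Suc i"] unfolding decseq_Suc_iff
        by (metis antisym_conv2 n_not_Suc_n order.trans order_antisym_conv)
      have "\<forall>\<^sub>F i in sequentially. c i < L + min d \<epsilon>"
        using L d(1) \<epsilon> by (intro order_tendstoD) auto
      then obtain i where i: "c i < L + min d \<epsilon>" by (auto simp: eventually_sequentially)
      have less: "c (Suc i) < c i"
        using decseqD[OF 2, of i "Suc i"] c_inj[of i "Suc i"] by force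
      have "\<Phi> (c i - c (Suc i)) (c (Suc i)) = c i"
      proof (rule Phi_c[OF less])
        show "k \<notin> {c (Suc i)<..c i}" if "k \<in> K" for k
          using d(2) that i L_less[of "Suc i"] by (force simp: dist_real_def)
      qed
      moreover have "r i < r (Suc i)" using strict_monoD[OF r(1)] by simp
      then have "(T ^^ (r (Suc i) - r i)) (c i) = c (Suc i)" by (simp add: c_def T_p)
      ultimately show ?thesis
        using less i L_less[of "Suc i"] c_unit[of i] \<open>r i < r (Suc i)\<close>
        by (intro exI[of _ "r (Suc i) - r i"] exI[of _ "c i - c (Suc i)"] exI[of _ "c i"]) auto
    next
      \<comment> \<open>In the increasing case the flow advances along the orbit, which is the wrong
        direction. Two such relations are compared instead: one with larger time \<open>s0\<close>
        but smaller power \<open>q0\<close>, the other with smaller time \<open>s'\<close> but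
        larger power.\<close>
      case 1
      have "c i \<le> L" for i using incseq_le[OF 1 L] .
      then have less_L: "c i < L" for i
        using 1 c_inj[of i "Suc i"] unfolding incseq_Suc_iff
        by (metis antisym_conv2 n_not_Suc_n order.trans order_antisym_conv)
      have less: "c i < c j" if "i < j" for i j
        using incseqD[OF 1, of i j] c_inj[of i j] that by force
      have "\<forall>\<^sub>F i in sequentially. c i > L - min d \<epsilon>"
        using L d(1) \<epsilon> by (intro order_tendstoD) auto
      then obtain N where N: "\<And>i. i \<ge> N \<Longrightarrow> c i > L - min d \<epsilon>" by (auto simp: eventually_sequentially)
      have Phi: "\<Phi> (c j - c i) (c i) = c j" if "N \<le> i" "i < j" for i j
      proof (rule Phi_c[OF less[OF that(2)]])
        show "k \<notin> {c i<..c j}" if "k \<in> K" for k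
          using d(2) that N[OF \<open>N \<le> i\<close>] less_L[of j] by (force simp: dist_real_def)
      qed
      define s0 where "s0 = c (Suc N) - c N"
      define q0 where "q0 = r (Suc N) - r N"
      have s0: "0 < s0" "s0 < \<epsilon>" using less[of N "Suc N"] N[of N] less_L[of "Suc N"] by (auto simp: s0_def)
      have "\<forall>\<^sub>F i in sequentially. c i > L - s0"
        using L s0(1) by (intro order_tendstoD) auto
      then obtain M where M: "\<And>i. i \<ge> M \<Longrightarrow> c i > L - s0" by (auto simp: eventually_sequentially)
      define j where "j = max M N"
      \<comment> \<open>As \<open>r\<close> grows by at least one per step, this choice makes
        \<open>r j' - r j\<close> exceed \<open>q0\<close>; the remaining power of \<open>T\<close>
        is then at least one.\<close>
      define j' where "j' = j + q0 + 1"
      have jj': "N \<le> j" "M \<le> j" "j < j'" by (auto simp: j_def j'_def)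
      define s' where "s' = c j' - c j"
      have s': "0 < s'" "s' < s0" using less[OF jj'(3)] M[OF jj'(2)] less_L[of j'] by (auto simp: s'_def)
      have rN: "r N < r (Suc N)" and rNj: "r N \<le> r j"
        using r(1) jj'(1) by (auto simp: strict_mono_less strict_mono_less_eq)
      have r_add: "r i + k \<le> r (i + k)" for i k
      proof (induction k)
        case (Suc k)
        then show ?case using strict_monoD[OF r(1), of "i + k" "Suc (i + k)"] by simp
      qed simp
      have rj': "r j + q0 < r j'" using r_add[of j "q0 + 1"] by (simp add: j'_def)
      have comm: "\<Phi> s0 ((T ^^ k) x) = (T ^^ k) (\<Phi> s0 x)" for k x
        using funpow_commute[OF flow_commute[OF s0], of k] by (simp add: fun_eq_iff)
      have eq0: "\<Phi> s0 (c N) = c (Suc N)" using Phi[of N "Suc N"] by (simp add: s0_def)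
      have "\<Phi> s0 (c j) = \<Phi> s0 ((T ^^ (r j - r N)) (c N))" using rNj by (simp add: c_def T_p)
      also have "\<dots> = (T ^^ (r j - r N)) (c (Suc N))" by (simp add: comm eq0)
      also have "\<dots> = p (r j + q0)" using rN rNj by (simp add: c_def T_p q0_def)
      finally have 1: "\<Phi> s0 (c j) = p (r j + q0)" .
      \<comment> \<open>Splitting the time \<open>s0\<close> at \<open>s'\<close> leaves a flow of
        time \<open>s0 - s'\<close> from \<open>c j'\<close> back to an earlier orbit point.\<close>
      have "\<Phi> (s0 - s') (c j') = \<Phi> (s0 - s') (\<Phi> s' (c j))"
        using Phi[OF jj'(1,3)] by (simp add: s'_def)
      also have "\<dots> = \<Phi> s0 (c j)"
        using flow_add[of "s0 - s'" s'] s' s0 by (simp add: fun_eq_iff)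
      finally have "\<Phi> (s0 - s') (c j') = p (r j + q0)" using 1 by simp
      moreover have "(T ^^ (r j' - (r j + q0))) (p (r j + q0)) = c j'"
        using rj' by (simp add: T_p c_def)
      ultimately show ?thesis using s' s0 rj' p_unit[of "r j + q0"]
        by (intro exI[of _ "r j' - (r j + q0)"] exI[of _ "s0 - s'"] exI[of _ "p (r j + q0)"]) auto
    qed
  qed
  then show thesis using that by blast
qed

text \<open>A flow time that undoes \<open>T ^^ q\<close> can be divided into equal parts and shared
  among the factors of the root.\<close>

lemma has_root: "\<exists>n\<ge>2. has_iet_root n T"
proof -
  obtain q s z where q: "q \<ge> 1" and s: "0 < s" "s < \<epsilon>" and z: "z \<in> {0..<1}"
    and fix_z: "\<Phi> s ((T ^^ q) z) = z"
    using flow_return .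
  have comm: "\<Phi> s ((T ^^ q) (T x)) = T (\<Phi> s ((T ^^ q) x))" for x
    using flow_commute[OF s] by (simp add: fun_eq_iff funpow_swap1)
  have T_unit: "x \<in> {0..<1} \<Longrightarrow> T x \<in> {0..<1}" for x using bij_image_unit[OF bij outside] .
  have Tq_unit: "x \<in> {0..<1} \<Longrightarrow> (T ^^ q) x \<in> {0..<1}" for x
    using iterate_unit[OF bij T_unit outside, of x "int q"] by (simp add: iterate_nat)
  have Tq_out: "x \<notin> {0..<1} \<Longrightarrow> (T ^^ q) x = x" for x
    by (induction q) (simp_all add: outside del: atLeastLessThan_iff)
  have bij_Tq: "bij (T ^^ q)" using bij by (rule bij_fn)
  have pt_return: "piecewise_translation (\<Phi> s \<circ> (T ^^ q))"
  proof (rule piecewise_translation_comp[OF flow_pt[OF s] piecewise_translation_funpow[OF bij outside pt]])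
    show "inj_on (T ^^ q) {0..<1}" using bij_is_inj[OF bij_Tq] by (rule inj_on_subset) simp
    show "(T ^^ q) ` {0..<1} \<subseteq> {0..<1}" using Tq_unit by blast
  qed
  \<comment> \<open>The return map commutes with \<open>T\<close>, so it fixes the whole orbit of
    \<open>z\<close>; minimality then makes it the identity.\<close>
  have fix_orbit: "(\<Phi> s \<circ> (T ^^ q)) (iterate T k z) = iterate T k z" for k
    using iterate_commute[OF bij, of "\<lambda>x. \<Phi> s ((T ^^ q) x)" k z, OF comm] fix_z by simp
  have id1: "\<Phi> s \<circ> (T ^^ q) = id"
  proof
    fix x
    show "(\<Phi> s \<circ> (T ^^ q)) x = id x"
    proof (cases "x \<in> {0..<1}")
      case True
      then show ?thesis using minimal_fixed_imp_id[OF pt_return fix_orbit min z] by simp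
    next
      case False
      then show ?thesis using Tq_out[OF False] flow_out[OF False] by simp
    qed
  qed
  then have id2: "(T ^^ q) \<circ> \<Phi> s = id" using funpow_commute[OF flow_commute[OF s]] by simp
  \<comment> \<open>With \<open>n * t = s\<close>, the power
    \<open>(T \<circ> \<Phi> t) ^^ n\<close> is \<open>T ^^ (q + 1) \<circ> \<Phi> s\<close>, and
    \<open>T ^^ q\<close> cancels \<open>\<Phi> s\<close>.\<close>
  define n where "n = q + 1"
  define t where "t = s / real n"
  have n: "n \<ge> 2" using q by (simp add: n_def)
  have t_n: "real n * t = s" using n by (simp add: t_def)
  have "t * 1 \<le> t * real n" using n s by (intro mult_left_mono) (auto simp: t_def)
  then have t: "0 < t" "t < \<epsilon>" using s n t_n by (auto simp: t_def mult.commute)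
  have pow: "\<Phi> t ^^ m = \<Phi> (real m * t)" if "1 \<le> m" "m \<le> n" for m
    using that
  proof (induction m rule: nat_induct_at_least)
    case (Suc m)
    have "real (Suc m) * t \<le> real n * t" using Suc.prems t(1) by (intro mult_right_mono) auto
    then have "t + real m * t < \<epsilon>" using t_n s(2) by (simp add: algebra_simps)
    then show ?case using Suc t(1) flow_add[of t "real m * t"] by (simp add: algebra_simps)
  qed simp
  have tn: "\<Phi> t ^^ n = \<Phi> s" using pow[of n] n t_n by simp
  have tn_Suc: "\<Phi> t ^^ Suc q = \<Phi> s" using tn by (simp only: n_def Suc_eq_plus1)
  \<comment> \<open>Splitting one factor \<open>\<Phi> t\<close> off \<open>\<Phi> s\<close> in the
    two identities above yields a right and a left inverse of \<open>\<Phi> t\<close>.\<close>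
  have right_inv: "\<Phi> t ((\<Phi> t ^^ q) ((T ^^ q) x)) = x" for x
    using fun_cong[OF tn_Suc, of "(T ^^ q) x"] fun_cong[OF id1, of x] by simp
  have left_inv: "(T ^^ q) ((\<Phi> t ^^ q) (\<Phi> t x)) = x" for x
    using fun_cong[OF tn_Suc, of x] fun_cong[OF id2, of x] by (simp add: funpow_swap1)
  have bij_t: "bij (\<Phi> t)"
  proof (rule bijI)
    show "inj (\<Phi> t)" using left_inv by (rule inj_on_inverseI)
    show "surj (\<Phi> t)" using right_inv by (rule surjI)
  qed
  define S where "S = T \<circ> \<Phi> t"
  have "S \<in> IETs"
  proof (rule IETs_I)
    show "bij S" unfolding S_def using bij_t bij by (rule bij_comp)
    show "x \<notin> {0..<1} \<Longrightarrow> S x = x" for x by (simp add: S_def flow_out outside del: atLeastLessThan_iff)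
    show "piecewise_translation S" unfolding S_def
    proof (rule piecewise_translation_comp[OF pt flow_pt[OF t]])
      show "inj_on (\<Phi> t) {0..<1}" using bij_is_inj[OF bij_t] by (rule inj_on_subset) simp
      show "\<Phi> t ` {0..<1} \<subseteq> {0..<1}"
        using bij_image_unit[OF bij_t flow_out] by blast
    qed
  qed
  moreover have "T = S ^^ n"
  proof -
    have "S ^^ n = (T ^^ n) \<circ> (\<Phi> t ^^ n)"
      unfolding S_def using flow_commute[OF t] by (rule funpow_comp_commute)
    also have "\<dots> = T \<circ> ((T ^^ q) \<circ> \<Phi> s)" unfolding tn by (simp add: n_def o_assoc)
    finally show ?thesis by (simp add: id2)
  qed
  ultimately show ?thesis using n unfolding has_iet_root_def by blast
qed

end

section \<open>Gliding along reglued intervals\<close>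

text \<open>Motion to the right on the reglued interval: the left germ at a cut \<open>k\<close>
  continues into the right germ at \<open>g k\<close>. The choice by \<open>THE\<close> is
  meaningful for times so small that at most one cut is met.\<close>

definition glide :: "real set \<Rightarrow> (real \<Rightarrow> real) \<Rightarrow> real \<Rightarrow> real \<Rightarrow> real" where
  "glide K g s x =
     (if x \<notin> {0..<1} then x
      else if K \<inter> {x<..x + s} = {} then x + s
      else let k = (THE k. k \<in> K \<inter> {x<..x + s}) in g k + (x + s - k))"

text \<open>\<open>Z\<close> is an \<open>\<epsilon>\<close>-separated set holding all cuts and all
  gluing targets, so a motion shorter than \<open>\<epsilon>\<close> jumps at most once. The end
  \<open>1\<close> is itself a cut, so no motion leaves \<open>{0..<1}\<close>.\<close>

locale gliding =
  fixes K Z :: "real set" and g :: "real \<Rightarrow> real" and \<epsilon> :: real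
  assumes finZ: "finite Z" and \<epsilon>: "\<epsilon> > 0"
    and gap: "\<And>y z. y \<in> Z \<Longrightarrow> z \<in> Z \<Longrightarrow> y < z \<Longrightarrow> y + \<epsilon> \<le> z"
    and K: "K \<subseteq> Z \<inter> {0<..1}" "1 \<in> K" and g: "g ` K \<subseteq> Z \<inter> {0..<1}"
begin

lemma glide_cut:
  assumes "k \<in> K" "0 \<le> x" "x < k" "k \<le> x + s" "s < \<epsilon>"
  shows "glide K g s x = g k + (x + s - k)"
proof -
  have "(THE k. k \<in> K \<inter> {x<..x + s}) = k"
  proof (rule the_equality)
    fix k' assume k': "k' \<in> K \<inter> {x<..x + s}"
    show "k' = k"
      using gap[of k k'] gap[of k' k] k' assms K(1) by (cases k k' rule: linorder_cases) auto
  qed (use assms in auto)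
  moreover have "x \<in> {0..<1}" "K \<inter> {x<..x + s} \<noteq> {}" using assms K(1) by auto
  ultimately show ?thesis unfolding glide_def by (simp del: atLeastLessThan_iff)
qed

lemma glide_no_cut:
  "x \<in> {0..<1} \<Longrightarrow> (\<And>k. k \<in> K \<Longrightarrow> x < k \<Longrightarrow> x + s < k) \<Longrightarrow> glide K g s x = x + s"
  unfolding glide_def by force

text \<open>The jump over \<open>k\<close> occurs exactly for starting points in
  \<open>{k - s..<k}\<close>, hence the additional cuts \<open>k - s\<close>.\<close>

lemma glide_piecewise_translation:
  assumes s: "0 < s" "s < \<epsilon>"
  shows "piecewise_translation (glide K g s)"
  unfolding piecewise_translation_def
proof (intro exI[of _ "K \<union> (\<lambda>k. k - s) ` K"] conjI allI impI)
  show "finite (K \<union> (\<lambda>k. k - s) ` K)" using K(1) finZ by (auto dest: finite_subset)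
  fix x y :: real
  assume *: "0 \<le> x \<and> x \<le> y \<and> y < 1 \<and> (K \<union> (\<lambda>k. k - s) ` K) \<inter> {x<..y} = {}"
  then have n: "k \<notin> {x<..y}" "k - s \<notin> {x<..y}" if "k \<in> K" for k using that by blast+
  show "glide K g s y - y = glide K g s x - x"
  proof (cases "\<exists>k\<in>K. x < k \<and> k \<le> x + s")
    case True
    then obtain k where k: "k \<in> K" "x < k" "k \<le> x + s" by blast
    moreover have "y < k" "k \<le> y + s" using n[OF k(1)] k * by auto
    ultimately show ?thesis using glide_cut[of k x s] glide_cut[of k y s] s * by auto
  next
    case False
    have "y + s < k" if "k \<in> K" "y < k" for k using False n[of k] that * by force
    moreover have "x + s < k" if "k \<in> K" "x < k" for k using False that by force
    ultimately show ?thesis using glide_no_cut[of x s] glide_no_cut[of y s] * by auto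
  qed
qed

text \<open>In total time below \<open>\<epsilon>\<close> at most one cut is crossed, in the first
  or in the second stretch: after a jump to \<open>g k\<close>, the next cut is at least
  \<open>\<epsilon>\<close> away.\<close>

lemma glide_add:
  assumes s: "0 < s" "0 < t" "s + t < \<epsilon>"
  shows "glide K g s \<circ> glide K g t = glide K g (s + t)"
proof
  fix x
  show "(glide K g s \<circ> glide K g t) x = glide K g (s + t) x"
  proof (cases "x \<in> {0..<1}")
    case False
    then show ?thesis unfolding glide_def by (simp del: atLeastLessThan_iff)
  next
    case x: True
    show ?thesis
    proof (cases "\<exists>k\<in>K. x < k \<and> k \<le> x + t")
      case True
      then obtain k where k: "k \<in> K" "x < k" "k \<le> x + t" by blast
      let ?u = "g k + (x + t - k)"
      have gk: "g k \<in> Z" "0 \<le> g k" "g k < 1" using g k(1) by auto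
      have 1: "glide K g t x = ?u" using glide_cut[OF k(1) _ k(2,3)] x s by auto
      have "g k + \<epsilon> \<le> 1" using gap[OF gk(1) _ gk(3)] K by auto
      then have "?u \<in> {0..<1}" using gk k s by auto
      moreover have "?u + s < k'" if "k' \<in> K" "?u < k'" for k'
        using gap[OF gk(1), of k'] that K(1) k s by auto
      ultimately have "glide K g s ?u = ?u + s" by (rule glide_no_cut)
      moreover have "glide K g (s + t) x = g k + (x + (s + t) - k)"
        using glide_cut[OF k(1) _ k(2)] k x s by auto
      ultimately show ?thesis using 1 by simp
    next
      case False
      then have n: "x + t < k" if "k \<in> K" "x < k" for k using that by force
      have 1: "glide K g t x = x + t" using glide_no_cut[OF x n] .
      have xt: "x + t \<in> {0..<1}" using n[OF K(2)] x s by auto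
      show ?thesis
      proof (cases "\<exists>k\<in>K. x + t < k \<and> k \<le> x + t + s")
        case True
        then obtain k where k: "k \<in> K" "x + t < k" "k \<le> x + t + s" by blast
        then have "glide K g s (x + t) = g k + (x + t + s - k)"
          "glide K g (s + t) x = g k + (x + (s + t) - k)"
          using glide_cut[of k "x + t" s] glide_cut[of k x "s + t"] x xt s by auto
        then show ?thesis using 1 by simp
      next
        case False
        have "x + (s + t) < k" if "k \<in> K" "x < k" for k using False n[OF that] that by force
        moreover have "x + t + s < k" if "k \<in> K" "x + t < k" for k using False that by force
        ultimately have "glide K g s (x + t) = x + t + s" "glide K g (s + t) x = x + (s + t)"
          using glide_no_cut[OF xt] glide_no_cut[OF x] by auto
        then show ?thesis using 1 by simp
      qed
    qed
  qed
qed

end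

section \<open>The reversing 3-IET and the regluing that it respects\<close>

definition flip_iet :: "real \<Rightarrow> real \<Rightarrow> real \<Rightarrow> real \<Rightarrow> real" where
  "flip_iet a b c x =
     (if 0 \<le> x \<and> x < a then x + b + c
      else if a \<le> x \<and> x < a + b then x + c - a
      else if a + b \<le> x \<and> x < 1 then x - a - b else x)"

locale flip =
  fixes a b c :: real
  assumes pos: "a > 0" "b > 0" "c > 0" and sum: "a + b + c = 1"
begin

abbreviation "T \<equiv> flip_iet a b c"
abbreviation "T' \<equiv> flip_iet c b a"

text \<open>The inverse reverses three intervals again, with the outer lengths swapped, so results
  of this locale also apply to it.\<close>

lemma T'_T [simp]: "T' (T x) = x" and T_T' [simp]: "T (T' x) = x"
  using pos sum by (auto simp: flip_iet_def)

lemma bij_T: "bij T"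
  by (rule o_bij[of T']) (simp_all add: fun_eq_iff)

lemma inv_T: "inv T = T'"
  by (rule inv_unique_comp) (simp_all add: fun_eq_iff)

lemma T_unit: "x \<in> {0..<1} \<Longrightarrow> T x \<in> {0..<1}"
  using pos sum by (auto simp: flip_iet_def)

lemma T_outside: "x \<notin> {0..<1} \<Longrightarrow> T x = x"
  using pos sum by (auto simp: flip_iet_def)

text \<open>The closure conditions on \<open>C\<close> say that the cuts form the orbit segment from \<open>b + c = T 0\<close> to \<open>a\<close>.\<close>

lemma glide_commutes:
  assumes C: "finite C" "C \<subseteq> {0<..<1}" "a \<in> C" "b + c \<in> C" "a + b \<notin> C" "c \<notin> C"
    and fwd: "\<And>k. k \<in> C \<Longrightarrow> k \<noteq> a \<Longrightarrow> T k \<in> C"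
    and bwd: "\<And>k. k \<in> C \<Longrightarrow> k \<noteq> b + c \<Longrightarrow> T' k \<in> C"
  obtains Z \<epsilon> where "gliding (insert 1 C) Z (\<lambda>k. if k = 1 then a else T' k) \<epsilon>"
    "\<And>s. 0 < s \<Longrightarrow> s < \<epsilon> \<Longrightarrow> T \<circ> glide (insert 1 C) (\<lambda>k. if k = 1 then a else T' k) s =
                      glide (insert 1 C) (\<lambda>k. if k = 1 then a else T' k) s \<circ> T"
proof -
  \<comment> \<open>The left germ at a cut joins the right germ at its preimage, and the left germ
    at \<open>1\<close> joins the one at \<open>a\<close>. \<open>T\<close> respects this: the left
    germ at \<open>a\<close> goes to that at \<open>1\<close>, the glued pair at \<open>1\<close>
    and \<open>a\<close> goes to the uncut point \<open>c\<close>, and \<open>a + b\<close> is torn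
    into the glued pair at \<open>b + c\<close> and \<open>0\<close>.\<close>
  let ?K = "insert 1 C" and ?g = "\<lambda>k. if k = 1 then a else T' k"
  \<comment> \<open>Cuts, gluing targets, end points, and the discontinuities of \<open>T\<close>
    and \<open>T'\<close>; \<open>\<epsilon>\<close> is chosen not to exceed any gap between
    them.\<close>
  define Z where "Z = C \<union> {0, 1, a, a + b, c, b + c}"
  have finZ: "finite Z" using C(1) by (simp add: Z_def)
  obtain \<epsilon> where \<epsilon>: "\<epsilon> > 0" "\<forall>d\<in>(\<lambda>(y, z). z - y) ` (Z \<times> Z). d \<noteq> 0 \<longrightarrow> \<epsilon> \<le> dist 0 d"
    using finite_set_avoid[of "(\<lambda>(y, z). z - y) ` (Z \<times> Z)" 0] finZ by blast
  have gap: "y + \<epsilon> \<le> z" if "y \<in> Z" "z \<in> Z" "y < z" for y z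
    using \<epsilon>(2) that by (force simp: dist_real_def)
  have T'_bc: "T' (b + c) = 0" using pos sum by (auto simp: flip_iet_def)
  have g_Z: "T' k \<in> Z \<and> 0 \<le> T' k \<and> T' k < 1" if "k \<in> C" for k
    using bwd[OF that] C(2) T'_bc by (cases "k = b + c") (auto simp: Z_def)
  interpret gliding ?K Z ?g \<epsilon>
  proof
    have "a \<in> Z \<inter> {0..<1}" using pos sum by (auto simp: Z_def)
    then show "?g ` ?K \<subseteq> Z \<inter> {0..<1}" using g_Z by auto
    show "?K \<subseteq> Z \<inter> {0<..1}" using C(2) by (auto simp: Z_def)
  qed (use finZ \<epsilon>(1) gap in auto)
  have inZ: "0 \<in> Z" "1 \<in> Z" "a \<in> Z" "a + b \<in> Z" "c \<in> Z" "b + c \<in> Z" "\<And>k. k \<in> C \<Longrightarrow> k \<in> Z"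
    by (auto simp: Z_def)
  have T_right: "T (w + h) = T w + h" if "w \<in> Z" "0 \<le> w" "w < 1" "0 \<le> h" "h < \<epsilon>" for w h
    using gap[OF that(1) inZ(2)] gap[OF that(1) inZ(3)] gap[OF that(1) inZ(4)] that pos sum
    by (auto simp: flip_iet_def)
  have T_left: "T (w - h) = T w - h"
    if "w \<in> Z" "0 < w" "w < 1" "w \<noteq> a" "w \<noteq> a + b" "0 \<le> h" "h < \<epsilon>" for w h
    using gap[OF inZ(1) that(1)] gap[OF inZ(3) that(1)] gap[OF inZ(4) that(1)] that pos sum
    by (auto simp: flip_iet_def)
  have comm: "T (glide ?K ?g s x) = glide ?K ?g s (T x)" if s: "0 < s" "s < \<epsilon>" for s x
  proof (cases "x \<in> {0..<1}")
    case False
    then show ?thesis using T_outside[OF False] unfolding glide_def by (simp del: atLeastLessThan_iff)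
  next
    case x: True
    have Tx: "T x \<in> {0..<1}" using x by (rule T_unit)
    consider (none) "\<And>k. k \<in> ?K \<Longrightarrow> x < k \<Longrightarrow> x + s < k"
      | (cut) k where "k \<in> C" "x < k" "k \<le> x + s" | (one) "1 \<le> x + s"
      using x by force
    then show ?thesis
    proof cases
      case none
      have xs: "x + s < 1" using none[of 1] x by auto
      have glide_x: "glide ?K ?g s x = x + s" using none by (rule glide_no_cut[OF x])
      have not_a: "x < a \<Longrightarrow> x + s < a" using none C(3) by blast
      show ?thesis
      \<comment> \<open>Crossing \<open>a + b\<close> without a cut: the image path meets the cut
        \<open>b + c\<close> and jumps to \<open>0\<close>, the image of
        \<open>a + b\<close>.\<close>
      proof (cases "x < a + b \<and> a + b \<le> x + s")
        case True
        have "a \<le> x" using gap[OF inZ(3,4)] True s pos by auto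
        then have T_x: "T x = x + c - a" using True by (auto simp: flip_iet_def)
        have "glide ?K ?g s (T x) = ?g (b + c) + (T x + s - (b + c))"
          using glide_cut[of "b + c" "T x" s] Tx T_x True s C(4) by auto
        also have "\<dots> = x + s - a - b" using T'_bc T_x pos sum by auto
        also have "\<dots> = T (x + s)" using True xs pos by (auto simp: flip_iet_def)
        finally show ?thesis using glide_x by simp
      next
        case False
        have T_h: "T (x + h) = T x + h" if "0 \<le> h" "h \<le> s" for h
          using False not_a that x xs pos sum by (auto simp: flip_iet_def)
        \<comment> \<open>A cut on the image path would pull back to a cut on the original path. The
          exception \<open>b + c\<close> has preimage \<open>0\<close>, which does not lie to the
          right of \<open>x\<close>.\<close>
        have "T x + s < k" if k: "k \<in> ?K" "T x < k" for k
        proof (rule ccontr)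
          assume "\<not> ?thesis"
          then have ks: "k \<le> T x + s" by simp
          have "x + s \<in> {0..<1}" using x xs s by auto
          then have "T x + s < 1" using T_unit[of "x + s"] T_h[of s] s by auto
          then have kC: "k \<in> C" using k ks by auto
          have "T' k = T' (T (x + (k - T x)))" using T_h[of "k - T x"] k ks by simp
          then have T'k: "T' k = x + (k - T x)" by simp
          have "k \<noteq> b + c" using T'k T'_bc k x by auto
          then have "T' k \<in> C" using bwd kC by blast
          then show False using none[of "T' k"] T'k k ks by auto
        qed
        then have "glide ?K ?g s (T x) = T x + s" by (rule glide_no_cut[OF Tx])
        then show ?thesis using glide_x T_h[of s] s by simp
      qed
    next
      case cut
      have k: "k \<noteq> 1" "0 < k" "k < 1" using C(2) cut by auto
      have "glide ?K ?g s x = T' k + (x + s - k)"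
        using glide_cut[of k x s] cut x s k by auto
      then have 1: "T (glide ?K ?g s x) = k + (x + s - k)"
        using T_right[of "T' k" "x + s - k"] g_Z[OF cut(1)] cut s by auto
      show ?thesis
      \<comment> \<open>At \<open>a\<close> the image path runs into \<open>1\<close> and is sent on
        to \<open>a\<close>; at any other cut it crosses the cut \<open>T k\<close>.\<close>
      proof (cases "k = a")
        case True
        have T_x: "T x = x + b + c" using cut True x by (auto simp: flip_iet_def)
        have "glide ?K ?g s (T x) = a + (T x + s - 1)"
          using glide_cut[of 1 "T x" s] T_x True cut s sum x pos by auto
        then show ?thesis using 1 T_x sum True by auto
      next
        case False
        have "k \<noteq> a + b" using cut C(5) by auto
        then have T_x: "T x = T k - (k - x)"
          using T_left[of k "k - x"] inZ(7)[OF cut(1)] k cut s False by auto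
        have "T k \<in> C" using fwd cut False by blast
        then have "glide ?K ?g s (T x) = T' (T k) + (T x + s - T k)"
          using glide_cut[of "T k" "T x" s] T_x Tx C(2) cut s by auto
        then show ?thesis using 1 T_x by simp
      qed
    next
      case one
      have "a + b \<le> x" using gap[OF inZ(4,2)] one s pos sum by auto
      then have T_x: "T x = x - a - b" using x pos by (auto simp: flip_iet_def)
      have "glide ?K ?g s x = a + (x + s - 1)"
        using glide_cut[of 1 x s] x one s by auto
      then have 1: "T (glide ?K ?g s x) = c + (x + s - 1)"
        using T_right[of a "x + s - 1"] inZ pos sum x one s by (auto simp: flip_iet_def)
      \<comment> \<open>The image path passes through \<open>c\<close>, which is not a cut, and by
        separation no other point of \<open>Z\<close> is near enough.\<close>
      have "T x + s < k" if k: "k \<in> ?K" "T x < k" for k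
      proof (rule ccontr)
        assume "\<not> ?thesis"
        moreover have "k \<in> Z" "k \<noteq> c" using k inZ C(6) pos sum by auto
        ultimately show False
          using gap[of k c] gap[of c k] inZ(5) T_x k x one s sum
          by (cases k c rule: linorder_cases) auto
      qed
      then have "glide ?K ?g s (T x) = T x + s" by (rule glide_no_cut[OF Tx])
      then show ?thesis using 1 T_x sum by simp
    qed
  qed
  show thesis
    by (rule that[OF gliding_axioms]) (use comm in \<open>simp add: fun_eq_iff\<close>)
qed

end

lemma iterate_inverse:
  assumes "bij T" "inv T = T'" "inv T' = T"
  shows "iterate T' k = iterate T (- k)"
  using assms by (cases "k = 0") (auto simp: iterate_def)

lemma gliding_has_root:
  assumes "gliding K Z g \<epsilon>"
    and comm: "\<And>s. 0 < s \<Longrightarrow> s < \<epsilon> \<Longrightarrow> T \<circ> glide K g s = glide K g s \<circ> T"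
    and "bij T" "\<And>x. x \<notin> {0..<1} \<Longrightarrow> T x = x" "piecewise_translation T" "minimal_iet T"
  shows "\<exists>n\<ge>2. has_iet_root n T"
proof -
  interpret gliding K Z g \<epsilon> by fact
  interpret commuting_flow T "glide K g" \<epsilon> K
  proof
    show "finite K" using K(1) finZ by (auto dest: finite_subset)
    show "x \<notin> {0..<1} \<Longrightarrow> glide K g s x = x" for x s
      unfolding glide_def by (simp del: atLeastLessThan_iff)
    show "glide K g s x = x + s" if "0 < s" "0 \<le> x" "x + s < 1" "K \<inter> {x<..x + s} = {}" for s x
      using that unfolding glide_def by auto
  qed (use assms \<epsilon> glide_piecewise_translation glide_add in auto)
  show ?thesis by (rule has_root)
qed

section \<open>Roots when the orbits of the two discontinuities meet\<close>

context flip
begin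

lemma T_points: "T 0 = b + c" "T a = c" "T (a + b) = 0"
  using pos sum by (auto simp: flip_iet_def)

lemma iterate_T_unit: "x \<in> {0..<1} \<Longrightarrow> iterate T k x \<in> {0..<1}"
  using iterate_unit[OF bij_T T_unit T_outside] .

text \<open>The cuts are \<open>T 0\<close> up to \<open>a\<close> on the forward orbit of
  \<open>0\<close>. Injectivity keeps \<open>a + b\<close>, the preimage of \<open>0\<close>, and
  \<open>c\<close>, the image of \<open>a\<close>, off this segment.\<close>

lemma connection_gliding:
  assumes inj: "inj (\<lambda>k. iterate T k 0)" and N: "iterate T (int N) 0 = a"
  obtains K Z g \<epsilon> where "gliding K Z g \<epsilon>"
    "\<And>s. 0 < s \<Longrightarrow> s < \<epsilon> \<Longrightarrow> T \<circ> glide K g s = glide K g s \<circ> T"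
proof -
  define p where "p i = (T ^^ i) 0" for i
  have p_inj: "p i = p j \<Longrightarrow> i = j" for i j
    using injD[OF inj, of "int i" "int j"] by (simp add: p_def iterate_nat)
  have p0: "p 0 = 0" and pS: "p (Suc i) = T (p i)" and pN: "p N = a" for i
    using N by (simp_all add: p_def iterate_nat)
  have p1: "p 1 = b + c" using p0 pS[of 0] T_points by simp
  have p_unit: "p i \<in> {0..<1}" for i
    using iterate_T_unit[of 0 "int i"] by (simp add: p_def iterate_nat)
  have N1: "1 \<le> N" using pN p0 pos by (cases N) auto
  let ?C = "p ` {1..N}"
  have fin: "finite ?C" by simp
  have sub: "?C \<subseteq> {0<..<1}"
  proof
    fix y assume "y \<in> ?C"
    then obtain i where i: "y = p i" "1 \<le> i" by auto
    then have "y \<noteq> 0" using p_inj[of i 0] p0 by auto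
    then show "y \<in> {0<..<1}" using p_unit[of i] i by auto
  qed
  have a: "a \<in> ?C" using N1 by (intro image_eqI[of _ _ N]) (simp_all add: pN)
  have "p 1 \<in> ?C" using N1 by (intro imageI) simp
  then have bc: "b + c \<in> ?C" by (simp only: p1)
  have ab: "a + b \<notin> ?C"
  proof
    assume "a + b \<in> ?C"
    then obtain i where "p i = a + b" by auto
    then have "p (Suc i) = p 0" using pS T_points p0 by simp
    then show False using p_inj by blast
  qed
  have c: "c \<notin> ?C"
  proof
    assume "c \<in> ?C"
    then obtain i where "p i = c" "i \<le> N" by auto
    then have "p i = p (Suc N)" using pS pN T_points by simp
    then show False using p_inj[of i "Suc N"] \<open>i \<le> N\<close> by simp
  qed
  have fwd: "T k \<in> ?C" if k: "k \<in> ?C" "k \<noteq> a" for k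
  proof -
    obtain i where i: "k = p i" "i \<in> {1..N}" using k by blast
    then have "Suc i \<in> {1..N}" using k(2) pN by (cases "i = N") auto
    then show ?thesis unfolding i(1) pS[of i, symmetric] by (rule imageI)
  qed
  have bwd: "T' k \<in> ?C" if k: "k \<in> ?C" "k \<noteq> b + c" for k
  proof -
    obtain i where i: "k = p i" "i \<in> {1..N}" using k by blast
    then have "i \<noteq> 1" using k(2) p1 by auto
    then have "i - 1 \<in> {1..N}" "i = Suc (i - 1)" using i by auto
    then have "T' k = p (i - 1)" using i(1) pS[of "i - 1"] by simp
    then show ?thesis using \<open>i - 1 \<in> {1..N}\<close> by blast
  qed
  show thesis
    by (rule glide_commutes[OF fin sub a bc ab c fwd bwd]) (assumption | rule that)+
qed

lemma connection_has_root:
  assumes min: "minimal_iet T" and pt: "piecewise_translation T"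
    and ij: "iterate T i a = iterate T j (a + b)"
  shows "\<exists>n\<ge>2. has_iet_root n T"
proof -
  interpret flipped: flip c b a using pos sum by unfold_locales auto
  have inj: "inj (\<lambda>k. iterate T k 0)"
    using infinite_orbit_inj[OF bij_T minimal_infinite_orbit[OF min]] by simp
  \<comment> \<open>One is subtracted because \<open>0\<close> is the image of
    \<open>a + b\<close>.\<close>
  define n where "n = j - i - 1"
  have "iterate T n 0 = iterate T (- i) (iterate T j (a + b))"
    using iterate_add[OF bij_T, of "j - i - 1" 1 "a + b"] iterate_add[OF bij_T, of "-i" j "a + b"]
    by (simp add: T_points n_def)
  also have "\<dots> = a"
    using iterate_add[OF bij_T, of "-i" i a] by (simp add: ij)
  finally have n: "iterate T n 0 = a" .
  have iter_T': "iterate T' k = iterate T (- k)" for k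
    using iterate_inverse[OF bij_T inv_T] flipped.inv_T by blast
  obtain K Z g \<epsilon> where gl: "gliding K Z g \<epsilon>"
    and comm: "\<And>s. 0 < s \<Longrightarrow> s < \<epsilon> \<Longrightarrow> T \<circ> glide K g s = glide K g s \<circ> T"
  proof (cases "0 \<le> n")
    case True
    then have "iterate T (int (nat n)) 0 = a" using n by simp
    then show thesis using connection_gliding[OF inj] that by blast
  next
    case False
    \<comment> \<open>If \<open>a\<close> precedes \<open>0\<close>, then \<open>c = T a\<close> is
      reached from \<open>0\<close> by \<open>T'\<close>, and \<open>c\<close> plays the part of
      \<open>a\<close> for the inverse. A flow commuting with \<open>T'\<close> commutes with
      \<open>T\<close>.\<close>
    have "iterate T' (int (nat (- n - 1))) 0 = c"
      using False n iterate_step[OF bij_T, of n 0] by (simp add: iter_T' T_points add.commute)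
    moreover have "inj (\<lambda>k. iterate T' k 0)"
    proof (rule injI)
      show "x = y" if "iterate T' x 0 = iterate T' y 0" for x y
        using injD[OF inj, of "- x" "- y"] that by (simp add: iter_T')
    qed
    ultimately obtain K Z g \<epsilon> where gl: "gliding K Z g \<epsilon>"
      and comm: "\<And>s. 0 < s \<Longrightarrow> s < \<epsilon> \<Longrightarrow> T' \<circ> glide K g s = glide K g s \<circ> T'"
      using flipped.connection_gliding by blast
    have "T \<circ> glide K g s = glide K g s \<circ> T" if "0 < s" "s < \<epsilon>" for s
    proof
      fix x
      have "T' (glide K g s (T x)) = glide K g s x"
        using fun_cong[OF comm[OF that], of "T x"] by simp
      then have "T (T' (glide K g s (T x))) = T (glide K g s x)" by (rule arg_cong)
      then show "(T \<circ> glide K g s) x = (glide K g s \<circ> T) x" by simp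
    qed
    then show thesis using that gl by blast
  qed
  show ?thesis by (rule gliding_has_root[OF gl comm bij_T T_outside pt min])
qed

end

section \<open>Left limits and the absence of roots\<close>

text \<open>The left germ at \<open>x\<close> is translated to the left germ at \<open>y\<close>; in
  particular \<open>y\<close> is the left limit of \<open>f\<close> at \<open>x\<close>.\<close>

definition left_value :: "(real \<Rightarrow> real) \<Rightarrow> real \<Rightarrow> real \<Rightarrow> bool" where
  "left_value f x y \<longleftrightarrow> (\<forall>\<^sub>F h in at_right 0. f (x - h) = y - h)"

lemma left_value_unique: "left_value f x y \<Longrightarrow> left_value f x z \<Longrightarrow> y = z"
proof -
  assume "left_value f x y" "left_value f x z"
  then have "\<forall>\<^sub>F h in at_right (0::real). y = z"
    unfolding left_value_def by eventually_elim simp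
  then show "y = z" by simp
qed

lemma left_value_comp: "left_value g x y \<Longrightarrow> left_value f y z \<Longrightarrow> left_value (f \<circ> g) x z"
  unfolding left_value_def by (erule (1) eventually_elim2) simp

lemma left_valueI:
  assumes "\<eta> > 0" "\<And>h. 0 < h \<Longrightarrow> h < \<eta> \<Longrightarrow> f (x - h) = y - h"
  shows "left_value f x y"
  unfolding left_value_def eventually_at_right_field using assms by auto

lemma left_value_range:
  assumes lv: "left_value f x y" and im: "\<And>x. x \<in> {0..<1} \<Longrightarrow> f x \<in> {0..<1}" and x: "x \<in> {0<..1}"
  shows "y \<in> {0<..1}"
proof -
  obtain \<eta> where \<eta>: "\<eta> > 0" "\<And>h. 0 < h \<Longrightarrow> h < \<eta> \<Longrightarrow> f (x - h) = y - h"
    using lv unfolding left_value_def eventually_at_right_field by auto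
  have b: "0 \<le> y - h \<and> y - h < 1" if "0 < h" "h < min \<eta> x" for h
    using im[of "x - h"] \<eta>(2)[of h] that x by auto
  have "0 < min \<eta> x" using \<eta>(1) x by auto
  have "0 < y" using b[of "min \<eta> x / 2"] \<open>0 < min \<eta> x\<close> by linarith
  moreover have "y \<le> 1"
  proof (rule ccontr)
    assume "\<not> y \<le> 1"
    then obtain h where "0 < h" "h < min (min \<eta> x) (y - 1)"
      using dense[of 0 "min (min \<eta> x) (y - 1)"] \<open>0 < min \<eta> x\<close> by auto
    then show False using b[of h] by auto
  qed
  ultimately show ?thesis by simp
qed

text \<open>Just to the left of any point there is no cut, so a left limit exists; it equals the
  value wherever the point is not a cut. Left limits live on \<open>{0<..1}\<close> in place of
  \<open>{0..<1}\<close>.\<close>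

lemma piecewise_translation_left_map:
  assumes pt: "piecewise_translation f" and im: "\<And>x. x \<in> {0..<1} \<Longrightarrow> f x \<in> {0..<1}"
  shows "\<exists>f' E. finite E \<and> (\<forall>x\<in>{0<..1}. left_value f x (f' x) \<and> f' x \<in> {0<..1}) \<and>
    (\<forall>x. x \<notin> {0<..1} \<longrightarrow> f' x = x) \<and> (\<forall>x\<in>{0<..<1} - E. f' x = f x)"
proof -
  obtain F where F: "finite F"
    "\<And>x y. \<lbrakk>0 \<le> x; x \<le> y; y < 1; F \<inter> {x<..y} = {}\<rbrakk> \<Longrightarrow> f y - y = f x - x"
    using pt unfolding piecewise_translation_def by blast
  have gap: "\<exists>\<eta>>0. \<eta> < x \<and> F \<inter> {x - \<eta><..<x} = {}" if x: "x \<in> {0<..1}" for x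
  proof -
    obtain d where "d > 0" "\<forall>p\<in>F. p \<noteq> x \<longrightarrow> d \<le> dist x p"
      using finite_set_avoid[OF F(1)] by blast
    then show ?thesis using x by (intro exI[of _ "min d (x / 2)"]) (force simp: dist_real_def)
  qed
  have ex: "\<exists>y. left_value f x y" if x: "x \<in> {0<..1}" for x
  proof -
    obtain \<eta> where \<eta>: "\<eta> > 0" "\<eta> < x" "F \<inter> {x - \<eta><..<x} = {}" using gap[OF x] by blast
    have "f (x - h) - (x - h) = f (x - \<eta> / 2) - (x - \<eta> / 2)" if "0 < h" "h < \<eta> / 2" for h
      by (rule F(2)) (use \<eta> x that in auto)
    then have "left_value f x (f (x - \<eta> / 2) + \<eta> / 2)"
      by (intro left_valueI[of "\<eta> / 2"]) (use \<eta>(1) in \<open>auto simp: algebra_simps\<close>)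
    then show ?thesis by blast
  qed
  have eq: "left_value f x (f x)" if x: "x \<in> {0<..<1}" "x \<notin> F" for x
  proof -
    obtain \<eta> where \<eta>: "\<eta> > 0" "\<eta> < x" "F \<inter> {x - \<eta><..<x} = {}" using gap[of x] x by auto
    have "f x - x = f (x - h) - (x - h)" if h: "0 < h" "h < \<eta>" for h
    proof (rule F(2))
      show "F \<inter> {x - h<..x} = {}"
      proof (rule ccontr)
        assume "F \<inter> {x - h<..x} \<noteq> {}"
        then obtain p where "p \<in> F" "x - h < p" "p \<le> x" by auto
        moreover have "p \<noteq> x" using x(2) \<open>p \<in> F\<close> by blast
        ultimately have "p \<in> F \<inter> {x - \<eta><..<x}" using h by auto
        then show False using \<eta>(3) by blast
      qed
    qed (use \<eta> x h in auto)
    then show ?thesis by (intro left_valueI[OF \<eta>(1)]) (auto simp: algebra_simps)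
  qed
  define f' where "f' x = (if x \<in> {0<..1} then SOME y. left_value f x y else x)" for x
  have lv: "left_value f x (f' x)" if "x \<in> {0<..1}" for x
    using someI_ex[OF ex[OF that]] that by (simp add: f'_def)
  show ?thesis
  proof (intro exI[of _ f'] exI[of _ F] conjI ballI allI impI)
    show "left_value f x (f' x)" "f' x \<in> {0<..1}" if "x \<in> {0<..1}" for x
      using lv[OF that] left_value_range[OF lv[OF that] im that] by blast+
    show "f' x = x" if "x \<notin> {0<..1}" for x
      unfolding f'_def using that by (rule if_not_P)
    show "f' x = f x" if "x \<in> {0<..<1} - F" for x
      using left_value_unique[OF lv eq] that by auto
  qed (rule F(1))
qed

text \<open>Only finitely many times hit \<open>E\<close>, so in the remote past and future of an
  orbit left limits and values agree.\<close>

lemma inj_avoids_finite: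
  fixes w :: "int \<Rightarrow> real"
  assumes "inj w" "finite E"
  obtains M where "\<And>k. M \<le> \<bar>k\<bar> \<Longrightarrow> w k \<notin> E"
proof -
  have fin: "finite {k. w k \<in> E}"
    using finite_vimageI[OF assms(2,1)] by (simp add: vimage_def)
  then have "\<bar>k\<bar> \<le> (\<Sum>i | w i \<in> E. \<bar>i\<bar>)" if "w k \<in> E" for k
    using that by (intro member_le_sum[where f = abs]) auto
  then show thesis by (intro that[of "(\<Sum>i | w i \<in> E. \<bar>i\<bar>) + 1"]) force
qed

text \<open>The left-limit map of \<open>flip_iet\<close>: the same translations on intervals closed
  on the right.\<close>

definition flip_left :: "real \<Rightarrow> real \<Rightarrow> real \<Rightarrow> real \<Rightarrow> real" where
  "flip_left a b c x =
     (if 0 < x \<and> x \<le> a then x + b + c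
      else if a < x \<and> x \<le> a + b then x + c - a
      else if a + b < x \<and> x \<le> 1 then x - a - b else x)"

section \<open>Delays between orbits of left germs and of points\<close>

context flip
begin

abbreviation "L \<equiv> flip_left a b c"

lemma bij_L: "bij L"
  by (rule o_bij[of "flip_left c b a"]) (use pos sum in \<open>auto simp: fun_eq_iff flip_left_def\<close>)

lemma L_unit: "x \<in> {0<..1} \<Longrightarrow> L x \<in> {0<..1}"
  using pos sum by (auto simp: flip_left_def)

lemma L_outside: "x \<notin> {0<..1} \<Longrightarrow> L x = x"
  using pos sum by (auto simp: flip_left_def)

lemma L_eq_T: "x \<in> {0<..<1} \<Longrightarrow> x \<noteq> a \<Longrightarrow> x \<noteq> a + b \<Longrightarrow> L x = T x"
  by (auto simp: flip_left_def flip_iet_def)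

lemma L_points: "L a = 1" "L 1 = c" "L (a + b) = b + c"
  using pos sum by (auto simp: flip_left_def)

lemma left_value_T:
  assumes x: "x \<in> {0<..1}" shows "left_value T x (L x)"
proof -
  consider "0 < x" "x \<le> a" | "a < x" "x \<le> a + b" | "a + b < x" "x \<le> 1" using x by force
  then show ?thesis
  proof cases
    case 1
    then show ?thesis by (intro left_valueI[of x]) (simp_all add: flip_left_def flip_iet_def)
  next
    case 2
    then show ?thesis using pos
      by (intro left_valueI[of "x - a"]) (simp_all add: flip_left_def flip_iet_def)
  next
    case 3
    then show ?thesis using pos
      by (intro left_valueI[of "x - (a + b)"]) (simp_all add: flip_left_def flip_iet_def)
  qed
qed

lemma disjoint_orbits_no_root:
  assumes injA: "inj (\<lambda>k. iterate T k a)" and injB: "inj (\<lambda>k. iterate T k (a + b))"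
    and disj: "\<And>i j. iterate T i a \<noteq> iterate T j (a + b)"
    and S: "S \<in> IETs" and root: "T = S ^^ n" and n: "n \<ge> 2"
  shows False
proof -
  have bijS: "bij S" and outS: "\<And>x. x \<notin> {0..<1} \<Longrightarrow> S x = x" and ptS: "piecewise_translation S"
    using S unfolding IETs_iff by blast+
  have S_unit: "x \<in> {0..<1} \<Longrightarrow> S x \<in> {0..<1}" for x using bij_image_unit[OF bijS outS] .
  obtain S' E where E: "finite E"
    and S': "\<forall>x\<in>{0<..1}. left_value S x (S' x) \<and> S' x \<in> {0<..1}"
    and S'_out: "\<forall>x. x \<notin> {0<..1} \<longrightarrow> S' x = x" and S'_eq: "\<forall>x\<in>{0<..<1} - E. S' x = S x"
    using piecewise_translation_left_map[OF ptS S_unit] by blast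
  have lvS: "x \<in> {0<..1} \<Longrightarrow> left_value S x (S' x)"
    and S'_unit: "x \<in> {0<..1} \<Longrightarrow> S' x \<in> {0<..1}" for x
    using S' by blast+
  have TS: "S (T x) = T (S x)" for x unfolding root by (simp add: funpow_swap1)
  \<comment> \<open>Both sides are left limits of the same map, since \<open>S\<close> commutes with
    its power \<open>T\<close>.\<close>
  have LS: "S' (L x) = L (S' x)" for x
  proof (cases "x \<in> {0<..1}")
    case True
    have 1: "left_value (S \<circ> T) x (S' (L x))"
      using left_value_comp[OF left_value_T[OF True] lvS[OF L_unit[OF True]]] .
    have 2: "left_value (T \<circ> S) x (L (S' x))"
      using left_value_comp[OF lvS[OF True] left_value_T[OF S'_unit[OF True]]] .
    have "S \<circ> T = T \<circ> S" using TS by (simp add: fun_eq_iff)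
    with 1 have "left_value (T \<circ> S) x (S' (L x))" by simp
    then show ?thesis using 2 by (rule left_value_unique)
  next
    case False
    then have "S' x = x" using S'_out by blast
    then show ?thesis using L_outside[OF False] by simp
  qed
  have S'_pow: "left_value (S ^^ k) x ((S' ^^ k) x) \<and> (S' ^^ k) x \<in> {0<..1}" if "x \<in> {0<..1}" for k x
  proof (induction k)
    case 0
    then show ?case using that by (auto simp: left_value_def)
  next
    case (Suc k)
    then show ?case unfolding funpow.simps comp_apply[of S' "S' ^^ k" x]
      using left_value_comp[OF _ lvS] S'_unit by blast
  qed
  have S'_root: "(S' ^^ n) x = L x" if "x \<in> {0<..1}" for x
    proof (rule left_value_unique)
    show "left_value T x ((S' ^^ n) x)" unfolding root using S'_pow[OF that] by blast
  qed (rule left_value_T[OF that])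

  define A where "A k = iterate T k a" for k
  define B where "B k = iterate T k (a + b)" for k
  have A_step: "T (A k) = A (k + 1)" and B_step: "T (B k) = B (k + 1)" for k
    by (simp_all add: A_def B_def iterate_step[OF bij_T])
  have A_inj: "A i = A j \<longleftrightarrow> i = j" and B_inj: "B i = B j \<longleftrightarrow> i = j" for i j
    using inj_eq[OF injA] inj_eq[OF injB] by (simp_all add: A_def B_def)
  have AB: "A i \<noteq> B j" for i j using disj by (simp add: A_def B_def)
  have A0: "A 0 = a" and B0: "B 0 = a + b" by (simp_all add: A_def B_def)
  have A1: "A 1 = c" and B1: "B 1 = 0" and B2: "B 2 = b + c"
    using A_step[of 0] B_step[of 0] B_step[of 1] A0 B0 T_points by simp_all
  have A_unit: "A k \<in> {0..<1}" and B_unit: "B k \<in> {0..<1}" for k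
    using iterate_T_unit pos sum by (simp_all add: A_def B_def)
  have A_pos: "A k \<in> {0<..<1}" for k using A_unit[of k] AB[of k 1] B1 by auto
  have B_pos: "B k \<in> {0<..<1}" if "k \<noteq> 1" for k using B_unit[of k] B_inj[of k 1] B1 that by auto
  have L_A: "L (A k) = A (k + 1)" if "k \<noteq> 0" for k
  proof -
    have "A k \<noteq> a" "A k \<noteq> a + b" using A_inj[of k 0] AB[of k 0] that unfolding A0 B0 by blast+
    then show ?thesis using L_eq_T[OF A_pos] A_step by simp
  qed
  have L_B: "L (B k) = B (k + 1)" if "k \<noteq> 0" "k \<noteq> 1" for k
  proof -
    have "B k \<noteq> a" "B k \<noteq> a + b" using B_inj[of k 0] AB[of 0 k] that unfolding A0 B0 by metis+
    then show ?thesis using L_eq_T[OF B_pos[OF that(2)]] B_step by simp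
  qed

  \<comment> \<open>The \<open>L\<close>-orbit of \<open>a\<close> makes a detour through
    \<open>1\<close> between \<open>a\<close> and \<open>c\<close>, so afterwards it lags one step
    behind \<open>A\<close>.\<close>
  define U where "U k = (if k \<le> 0 then A k else if k = 1 then 1 else A (k - 1))" for k
  \<comment> \<open>The \<open>L\<close>-orbit of \<open>a + b\<close> goes directly to
    \<open>b + c\<close>, omitting \<open>B 1 = 0\<close>, so afterwards it is one step ahead of
    \<open>B\<close>.\<close>
  define V where "V k = (if k \<le> 0 then B k else B (k + 1))" for k
  have U: "U k = iterate L k a" for k
  proof -
    have "L (U k) = U (k + 1)" for k
      using L_A[of k] L_A[of "k - 1"] L_points A0 A1 by (auto simp: U_def)
    from bij_step_eq_iterate[where w = U, OF bij_L this] show ?thesis by (simp add: U_def A0)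
  qed
  have V: "V k = iterate L k (a + b)" for k
  proof -
    have "L (V k) = V (k + 1)" for k
      using L_B[of k] L_B[of "k + 1"] L_points B0 B2 by (cases "k = 0") (auto simp: V_def)
    from bij_step_eq_iterate[where w = V, OF bij_L this] show ?thesis by (simp add: V_def B0)
  qed
  have V_inj: "V i = V j \<Longrightarrow> i = j" for i j
    using B_inj by (auto simp: V_def split: if_splits)

  define u where "u = S' (a + b)"
  define v where "v = S (a + b)"
  have u_unit: "u \<in> {0<..1}" unfolding u_def using S'_unit pos sum by simp
  \<comment> \<open>\<open>0\<close> is avoided together with \<open>E\<close> because
    \<open>S'\<close> is compared with \<open>S\<close> only on \<open>{0<..<1}\<close>.\<close>
  obtain M0 where M0: "\<And>k. M0 \<le> \<bar>k\<bar> \<Longrightarrow> B k \<notin> insert 0 E"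
  proof -
    have "inj B" by (simp add: inj_def B_inj)
    then show thesis using inj_avoids_finite[of B "insert 0 E"] E that by blast
  qed
  have S'_B: "S' (B k) = S (B k)" if "M0 \<le> \<bar>k\<bar>" for k
    using S'_eq M0[OF that] B_unit[of k] by auto
  have S_B: "S (B k) = iterate T k v" for k
    using iterate_commute[OF bij_T, of S k "a + b"] TS by (simp add: B_def v_def)
  have S'_V: "S' (V k) = iterate L k u" for k
    using iterate_commute[OF bij_L, of S' k "a + b"] LS by (simp add: V u_def)
  define M where "M = \<bar>M0\<bar> + 1"
  \<comment> \<open>Applying \<open>S'\<close> and \<open>S\<close> carries the delay of the pair
    \<open>V\<close>, \<open>B\<close> over to the pair of orbits of \<open>u\<close> and
    \<open>v\<close>: equal in the past, one step ahead in the future.\<close>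
  have backward: "iterate L k u = iterate T k v" if "k \<le> - M" for k
  proof -
    have "V k = B k" "M0 \<le> \<bar>k\<bar>" using that by (auto simp: V_def M_def)
    then show ?thesis using S'_V[of k] S'_B[of k] S_B[of k] by simp
  qed
  have forward: "iterate L k u = iterate T (k + 1) v" if "M \<le> k" for k
  proof -
    have "V k = B (k + 1)" "M0 \<le> \<bar>k + 1\<bar>" using that by (auto simp: V_def M_def)
    then show ?thesis using S'_V[of k] S'_B[of "k + 1"] S_B[of "k + 1"] by simp
  qed
  have cancel: "x = y" if "iterate T k x = iterate T k y" for k x y
    using iterate_add[OF bij_T, of "- k" k x] iterate_add[OF bij_T, of "- k" k y] that by simp

  consider i where "u = U i" | i where "u = V i" | "\<And>i. u \<noteq> U i" "\<And>i. u \<noteq> V i" by blast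
  then show False
  proof cases
    \<comment> \<open>On the orbit of \<open>a\<close> the past forces \<open>v = A i\<close>, but
      then the germ lags by one step in the future instead of leading.\<close>
    case 1
    have it: "iterate L k u = U (k + i)" for k
      using iterate_add[OF bij_L, of k i a] 1 by (simp add: U)
    define k where "k = - M - \<bar>i\<bar>"
    have "iterate T k v = A (k + i)"
      using backward[of k] it[of k] by (auto simp: k_def U_def M_def)
    then have "iterate T k v = iterate T k (A i)"
      using iterate_add[OF bij_T, of k i a] by (simp add: A_def)
    then have "v = A i" by (rule cancel)
    define m where "m = M + \<bar>i\<bar> + 1"
    have "iterate T (m + 1) v = A (m + i - 1)"
      using forward[of m] it[of m] by (auto simp: m_def U_def M_def)
    moreover have "iterate T (m + 1) v = A (m + 1 + i)"
      using iterate_add[OF bij_T, of "m + 1" i a] \<open>v = A i\<close> by (simp add: A_def)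
    ultimately show False using A_inj by auto
  next
    \<comment> \<open>Here \<open>S'\<close> shifts \<open>V\<close> by \<open>i\<close>, so its
      \<open>n\<close>-th power shifts by \<open>n * i\<close>, while \<open>L\<close> shifts by
      one.\<close>
    case 2
    have "(S' ^^ k) (a + b) = V (int k * i)" for k
    proof (induction k)
      case 0
      then show ?case by (simp add: V_def B0)
    next
      case (Suc k)
      have "(S' ^^ Suc k) (a + b) = iterate L (int k * i) u" using Suc S'_V by simp
      also have "\<dots> = V (int k * i + i)"
        using iterate_add[OF bij_L, of "int k * i" i "a + b"] 2 by (simp add: V)
      finally show ?case by (simp add: algebra_simps)
    qed
    then have "V (int n * i) = V 1"
      using S'_root[of "a + b"] pos sum by (simp add: L_points V_def B2)
    then have "int n * i = 1" by (rule V_inj)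
    then show False using n by (auto simp: zmult_eq_1_iff)
  next
    \<comment> \<open>The orbit of \<open>u\<close> misses \<open>a\<close>, \<open>1\<close> and
      \<open>a + b\<close>, so \<open>L\<close> and \<open>T\<close> coincide along it and there is
      no delay; the future then gives \<open>T v = v\<close>.\<close>
    case 3
    have unit: "iterate L k u \<in> {0<..1}" for k
      using iterate_unit[OF bij_L L_unit L_outside u_unit] .
    have not: "iterate L k u \<noteq> iterate L j x" if "\<And>i. u \<noteq> iterate L i x" for k j x
    proof
      assume *: "iterate L k u = iterate L j x"
      have "u = iterate L (- k) (iterate L k u)" using iterate_add[OF bij_L, of "- k" k u] by simp
      also have "\<dots> = iterate L (- k + j) x" unfolding * using iterate_add[OF bij_L, of "- k" j x] by simp
      finally show False using that by blast
    qed
    have U01: "U 0 = a" "U 1 = 1" "V 0 = a + b" by (simp_all add: U_def V_def A0 B0)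
    have "T (iterate L k u) = iterate L (k + 1) u" for k
    proof -
      have "iterate L k u \<noteq> a" "iterate L k u \<noteq> 1" "iterate L k u \<noteq> a + b"
        using not[of a k 0] not[of a k 1] not[of "a + b" k 0] 3 U01 by (auto simp: U V)
      then have "L (iterate L k u) = T (iterate L k u)"
        using unit[of k] by (intro L_eq_T) auto
      then show ?thesis by (simp add: iterate_step[OF bij_L])
    qed
    from bij_step_eq_iterate[where w = "\<lambda>k. iterate L k u", OF bij_T this] have it: "iterate L k u = iterate T k u" for k by simp
    have "iterate T (- M) u = iterate T (- M) v" using backward[of "- M"] it[of "- M"] by simp
    then have "u = v" by (rule cancel)
    have "iterate T M u = iterate T M (T v)"
      using forward[of M] it[of M] iterate_add[OF bij_T, of M 1 v] by simp
    then have "u = T v" by (rule cancel)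
    then have "T v = v" using \<open>u = v\<close> by simp
    then have "S (T (a + b)) = S (a + b)" by (simp add: v_def TS)
    then have "T (a + b) = a + b" using bijS by (simp add: bij_is_inj inj_eq)
    then show False using T_points pos by simp
  qed
qed

end

section \<open>Reduction to the reversing permutation\<close>

lemma break_point_1_2: "break_point l 1 = l 1" "break_point l 2 = l 1 + l 2"
  by (simp_all add: break_point_def numeral_2_eq_2)

lemma iet_3_eq:
  assumes l: "l \<in> length_vectors 3"
  shows "0 \<le> x \<Longrightarrow> x < l 1 \<Longrightarrow> iet 3 \<pi> l x =
      x + (if \<pi> 2 < \<pi> 1 then l 2 else 0) + (if \<pi> 3 < \<pi> 1 then l 3 else 0)"
    and "l 1 \<le> x \<Longrightarrow> x < l 1 + l 2 \<Longrightarrow> iet 3 \<pi> l x =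
      x - l 1 + (if \<pi> 1 < \<pi> 2 then l 1 else 0) + (if \<pi> 3 < \<pi> 2 then l 3 else 0)"
    and "l 1 + l 2 \<le> x \<Longrightarrow> x < 1 \<Longrightarrow> iet 3 \<pi> l x =
      x - l 1 - l 2 + (if \<pi> 1 < \<pi> 3 then l 1 else 0) + (if \<pi> 2 < \<pi> 3 then l 2 else 0)"
proof -
  have set: "{1..3} = {1, 2, 3::nat}" by auto
  have sum: "(\<Sum>i | i \<in> {1..3} \<and> \<pi> i < k. l i) =
    (if \<pi> 1 < k then l 1 else 0) + (if \<pi> 2 < k then l 2 else 0) + (if \<pi> 3 < k then l 3 else 0)" for k
  proof -
    have "(\<Sum>i | i \<in> {1..3} \<and> \<pi> i < k. l i) = (\<Sum>i\<in>{1..3}. if \<pi> i < k then l i else 0)"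
      by (rule sum.inter_filter) simp
    then show ?thesis unfolding set by simp
  qed
  note bp = break_point_1_2 break_point_full[OF l]
  show "0 \<le> x \<Longrightarrow> x < l 1 \<Longrightarrow> iet 3 \<pi> l x =
      x + (if \<pi> 2 < \<pi> 1 then l 2 else 0) + (if \<pi> 3 < \<pi> 1 then l 3 else 0)"
    using iet_eq[OF l, of 1 x \<pi>, unfolded sum] by (simp add: bp)
  show "l 1 \<le> x \<Longrightarrow> x < l 1 + l 2 \<Longrightarrow> iet 3 \<pi> l x =
      x - l 1 + (if \<pi> 1 < \<pi> 2 then l 1 else 0) + (if \<pi> 3 < \<pi> 2 then l 3 else 0)"
    using iet_eq[OF l, of 2 x \<pi>, unfolded sum] by (simp add: bp)
  show "l 1 + l 2 \<le> x \<Longrightarrow> x < 1 \<Longrightarrow> iet 3 \<pi> l x =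
      x - l 1 - l 2 + (if \<pi> 1 < \<pi> 3 then l 1 else 0) + (if \<pi> 2 < \<pi> 3 then l 2 else 0)"
    using iet_eq[OF l, of 3 x \<pi>, unfolded sum] by (simp add: bp)
qed

text \<open>Of the six permutations, those fixing the first or the last interval give a fixed point,
  against minimality, and the two nontrivial cyclic ones give rotations. Only the reversal is
  left.\<close>

lemma minimal_non_rotation_3_iet:
  assumes p: "\<pi> permutes {1..3}" and l: "l \<in> length_vectors 3"
    and min: "minimal_iet (iet 3 \<pi> l)" and rot: "\<not> rotation_type (iet 3 \<pi> l)"
  shows "iet 3 \<pi> l = flip_iet (l 1) (l 2) (l 3)"
proof -
  have set: "{1..3} = {1, 2, 3::nat}" by auto
  have pos: "l 1 > 0" "l 2 > 0" "l 3 > 0" and sum: "l 1 + l 2 + l 3 = 1"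
    using l unfolding length_vectors_def set by auto
  note T_eq = iet_3_eq[OF l, of _ \<pi>]
  have no_fix: "iet 3 \<pi> l x \<noteq> x" if "x \<in> {0..<1}" for x
    using injD[OF infinite_orbit_inj[OF bij_iet[OF p l] minimal_infinite_orbit[OF min that]], of 0 1]
    by auto
  \<comment> \<open>Rotation type is tested by displacements that agree modulo integers, which
    avoids computing \<open>frac\<close> on each interval.\<close>
  have no_rot: "\<not> (\<forall>x\<in>{0..<1}. iet 3 \<pi> l x - x - \<alpha> \<in> \<int>)" for \<alpha>
  proof
    assume *: "\<forall>x\<in>{0..<1}. iet 3 \<pi> l x - x - \<alpha> \<in> \<int>"
    have "iet 3 \<pi> l x = frac (x + \<alpha>)" if x: "x \<in> {0..<1}" for x
    proof -
      have "iet 3 \<pi> l x \<in> {0..<1}"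
        using bij_image_unit[OF bij_iet[OF p l] iet_outside x] .
      moreover have "x + \<alpha> - iet 3 \<pi> l x \<in> \<int>"
        using Ints_minus[OF bspec[OF * x]] by (simp add: algebra_simps)
      ultimately have "frac (x + \<alpha>) = iet 3 \<pi> l x" unfolding frac_unique_iff by auto
      then show ?thesis by simp
    qed
    then show False using rot unfolding rotation_type_def by blast
  qed
  have pieces: "0 \<le> x \<and> x < l 1 \<or> l 1 \<le> x \<and> x < l 1 + l 2 \<or> l 1 + l 2 \<le> x \<and> x < 1"
    if "x \<in> {0..<1}" for x using that by auto
  have inj: "\<pi> i = \<pi> j \<longleftrightarrow> i = j" for i j using permutes_inj[OF p] by (simp add: inj_eq)
  have Z: "{0, -1} \<subseteq> (\<int> :: real set)" by auto
  consider "\<pi> 1 < \<pi> 2 \<and> \<pi> 2 < \<pi> 3" | "\<pi> 1 < \<pi> 3 \<and> \<pi> 3 < \<pi> 2" | "\<pi> 2 < \<pi> 1 \<and> \<pi> 1 < \<pi> 3"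
    | "\<pi> 3 < \<pi> 1 \<and> \<pi> 1 < \<pi> 2" | "\<pi> 2 < \<pi> 3 \<and> \<pi> 3 < \<pi> 1" | "\<pi> 3 < \<pi> 2 \<and> \<pi> 2 < \<pi> 1"
    using inj[of 1 2] inj[of 2 3] inj[of 1 3] by force
  then show ?thesis
  proof cases
    case 1
    then show ?thesis using T_eq(1)[of 0] no_fix[of 0] pos by auto
  next
    case 2
    then show ?thesis using T_eq(1)[of 0] no_fix[of 0] pos by auto
  next
    case 3
    then show ?thesis using T_eq(3)[of "l 1 + l 2"] no_fix[of "l 1 + l 2"] pos sum by auto
  next
    case 4
    have "iet 3 \<pi> l x - x - l 3 \<in> {0, -1}" if "x \<in> {0..<1}" for x
      using pieces[OF that] by (elim disjE conjE) (use 4 sum in \<open>simp_all add: T_eq\<close>)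
    then show ?thesis using no_rot[of "l 3"] Z by blast
  next
    case 5
    have "iet 3 \<pi> l x - x - (l 2 + l 3) \<in> {0, -1}" if "x \<in> {0..<1}" for x
      using pieces[OF that] by (elim disjE conjE) (use 5 sum in \<open>simp_all add: T_eq\<close>)
    then show ?thesis using no_rot[of "l 2 + l 3"] Z by blast
  next
    case 6
    show ?thesis
    proof
      fix x
      show "iet 3 \<pi> l x = flip_iet (l 1) (l 2) (l 3) x"
      proof (cases "x \<in> {0..<1}")
        case True
        then show ?thesis using pieces[OF True]
          by (elim disjE conjE) (use 6 pos in \<open>auto simp: T_eq flip_iet_def\<close>)
      next
        case False
        then show ?thesis using iet_outside[OF False] pos sum by (auto simp: flip_iet_def)
      qed
    qed
  qed
qed

theorem theorem1p5:
  fixes \<pi> :: "nat \<Rightarrow> nat" and l :: "nat \<Rightarrow> real" and T :: "real \<Rightarrow> real"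
  assumes "\<pi> permutes {1..3}"
    and "l \<in> length_vectors 3"
    and "T = iet 3 \<pi> l"
    and "minimal_iet T"
    and "\<not> rotation_type T"
  shows "(\<exists>n\<ge>2. has_iet_root n T) \<longleftrightarrow> \<not> idoc 3 \<pi> l"
proof -
  have set: "{1..3} = {1, 2, 3::nat}" "{1..3 - 1} = {1, 2::nat}" by auto
  have pos: "l 1 > 0" "l 2 > 0" "l 3 > 0" and sum: "l 1 + l 2 + l 3 = 1"
    using assms(2) unfolding length_vectors_def set by auto
  interpret flip "l 1" "l 2" "l 3" using pos sum by unfold_locales
  have T: "iet 3 \<pi> l = flip_iet (l 1) (l 2) (l 3)"
    using minimal_non_rotation_3_iet assms by blast
  have min: "minimal_iet (flip_iet (l 1) (l 2) (l 3))" using assms(3,4) T by simp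
  let ?O = "iet_orbit (flip_iet (l 1) (l 2) (l 3))"
  have inf: "infinite (?O (l 1))" "infinite (?O (l 1 + l 2))"
    using minimal_infinite_orbit[OF min] pos sum by simp_all
  \<comment> \<open>Minimality makes both orbits infinite, so only their disjointness remains of the
    condition.\<close>
  have idoc_iff: "idoc 3 \<pi> l \<longleftrightarrow> ?O (l 1) \<inter> ?O (l 1 + l 2) = {}"
    unfolding idoc_def set T using inf by (simp add: break_point_1_2 Int_commute del: One_nat_def)
  show ?thesis
  proof
    assume "\<exists>n\<ge>2. has_iet_root n T"
    then obtain n S where "n \<ge> 2" "S \<in> IETs" "flip_iet (l 1) (l 2) (l 3) = S ^^ n"
      using assms(3) T unfolding has_iet_root_def by auto
    then show "\<not> idoc 3 \<pi> l"
      using disjoint_orbits_no_root[OF infinite_orbit_inj[OF bij_T inf(1)] infinite_orbit_inj[OF bij_T inf(2)]]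
      unfolding idoc_iff iet_orbit_def by blast
  next
    assume "\<not> idoc 3 \<pi> l"
    then obtain i j where "iterate (flip_iet (l 1) (l 2) (l 3)) i (l 1) = iterate (flip_iet (l 1) (l 2) (l 3)) j (l 1 + l 2)"
      unfolding idoc_iff iet_orbit_def by auto
    moreover have "piecewise_translation (flip_iet (l 1) (l 2) (l 3))"
      using piecewise_translation_iet[OF assms(2), of \<pi>] T by simp
    ultimately show "\<exists>n\<ge>2. has_iet_root n T"
      using connection_has_root[OF min] assms(3) T by simp
  qed
qed

end
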